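(* The family $\overline{\mathfrak{n}}_t = (\mathbb{R}^9,\overline\mu_t)$, $t\in(1,\infty)$, is a curve of pairwise non-isomorphic nilpotent Lie algebras, none of which is an Einstein nilradical. That is: for $t,s\in(1,\infty)$ with $t\neq s$ the real Lie algebras $\overline{\mathfrak{n}}_t$ and $\overline{\mathfrak{n}}_s$ are not isomorphic, and for every $t\in(1,\infty)$ the Lie algebra $\overline{\mathfrak{n}}_t$ is not an Einstein nilradical.
   Context: Let $e_1,\dots,e_9$ be the canonical basis of $\mathbb{R}^9$. For $t\in\mathbb{R}$, $\overline{\mathfrak{n}}_t=(\mathbb{R}^9,\overline\mu_t)$ is the real $2$-step nilpotent Lie algebra whose bracket $\overline\mu_t$ is the skew-symmetric bilinear map determined by $$\overline\mu_t(e_5,e_4)=e_7,\quad \overline\mu_t(e_1,e_6)=e_8,\quad \overline\mu_t(e_3,e_2)=e_9,$$ $$\overline\mu_t(e_3,e_6)=t\,e_7,\quad \overline\mu_t(e_5,e_2)=t\,e_8,\quad \overline\mu_t(e_1,e_4)=t\,e_9,$$ $$\overline\mu_t(e_1,e_2)=e_7,\quad \overline\mu_t(e_3,e_4)=e_8,$$ all other brackets of basis vectors not obtained from these by skew-symmetry being zero. Einstein nilradical: a real nilpotent Lie algebra $\mathfrak{n}$ is called an Einstein nilradical if it is the nilradical (maximal nilpotent ideal) of the Lie algebra of a (standard) Einstein solvmanifold. Equivalently, $\mathfrak{n}$ admits an inner product $\langle\cdot,\cdot\rangle$ such that $\mathrm{Ric}_{\langle\cdot,\cdot\rangle}=cI+D$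 for some $c\in\mathbb{R}$ and some derivation $D\in\mathrm{Der}(\mathfrak{n})$. Here $\mathrm{Ric}_{\langle\cdot,\cdot\rangle}$ is the Ricci operator of the corresponding left invariant metric on the simply connected Lie group with Lie algebra $\mathfrak{n}$; for a nilpotent Lie algebra with bracket $\mu$ and any orthonormal basis $\{x_i\}$ of $(\mathfrak{n},\langle\cdot,\cdot\rangle)$ it is given by $$\langle \mathrm{Ric}\,X,Y\rangle=-\tfrac12\sum_{i,j}\langle\mu(X,x_i),x_j\rangle\langle\mu(Y,x_i),x_j\rangle+\tfrac14\sum_{i,j}\langle\mu(x_i,x_j),X\rangle\langle\mu(x_i,x_j),Y\rangle .$$ *)

theory Defs
  imports "HOL-Analysis.Analysis"
begin

section \<open>Real Lie algebras\<close>

definition lie_algebra :: "('a::real_vector \<Rightarrow> 'a \<Rightarrow> 'a) \<Rightarrow> bool" where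
  "lie_algebra br \<longleftrightarrow> bilinear br \<and> (\<forall>x. br x x = 0) \<and>
     (\<forall>x y z. br x (br y z) + br y (br z x) + br z (br x y) = 0)"

definition bracket_span :: "('a::real_vector \<Rightarrow> 'a \<Rightarrow> 'a) \<Rightarrow> 'a set \<Rightarrow> 'a set \<Rightarrow> 'a set" where
  "bracket_span br A B = span {br x y | x y. x \<in> A \<and> y \<in> B}"

primrec lower_central :: "('a::real_vector \<Rightarrow> 'a \<Rightarrow> 'a) \<Rightarrow> 'a set \<Rightarrow> nat \<Rightarrow> 'a set" where
  "lower_central br L 0 = L"
| "lower_central br L (Suc k) = bracket_span br L (lower_central br L k)"

primrec derived_series :: "('a::real_vector \<Rightarrow> 'a \<Rightarrow> 'a) \<Rightarrow> 'a set \<Rightarrow> nat \<Rightarrow> 'a set" where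
  "derived_series br L 0 = L"
| "derived_series br L (Suc k) = bracket_span br (derived_series br L k) (derived_series br L k)"

definition lie_nilpotent_on :: "('a::real_vector \<Rightarrow> 'a \<Rightarrow> 'a) \<Rightarrow> 'a set \<Rightarrow> bool" where
  "lie_nilpotent_on br L \<longleftrightarrow> (\<exists>k. lower_central br L k = {0})"

definition lie_solvable_on :: "('a::real_vector \<Rightarrow> 'a \<Rightarrow> 'a) \<Rightarrow> 'a set \<Rightarrow> bool" where
  "lie_solvable_on br L \<longleftrightarrow> (\<exists>k. derived_series br L k = {0})"

definition lie_ideal :: "('a::real_vector \<Rightarrow> 'a \<Rightarrow> 'a) \<Rightarrow> 'a set \<Rightarrow> bool" where
  "lie_ideal br I \<longleftrightarrow> subspace I \<and> (\<forall>x. \<forall>y\<in>I. br x y \<in> I)"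

definition is_nilradical :: "('a::real_vector \<Rightarrow> 'a \<Rightarrow> 'a) \<Rightarrow> 'a set \<Rightarrow> bool" where
  "is_nilradical br N \<longleftrightarrow> lie_ideal br N \<and> lie_nilpotent_on br N \<and>
     (\<forall>I. lie_ideal br I \<and> lie_nilpotent_on br I \<longrightarrow> I \<subseteq> N)"

text \<open>The Lie algebra \<open>('a, br)\<close> is isomorphic to the subalgebra with carrier \<open>L\<close> of \<open>('b, br')\<close>.\<close>
definition lie_isomorphic_onto ::
  "('a::real_vector \<Rightarrow> 'a \<Rightarrow> 'a) \<Rightarrow> ('b::real_vector \<Rightarrow> 'b \<Rightarrow> 'b) \<Rightarrow> 'b set \<Rightarrow> bool" where
  "lie_isomorphic_onto br br' L \<longleftrightarrow>
     (\<exists>\<phi>. linear \<phi> \<and> bij_betw \<phi> UNIV L \<and> (\<forall>x y. \<phi> (br x y) = br' (\<phi> x) (\<phi> y)))"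

abbreviation lie_isomorphic ::
  "('a::real_vector \<Rightarrow> 'a \<Rightarrow> 'a) \<Rightarrow> ('b::real_vector \<Rightarrow> 'b \<Rightarrow> 'b) \<Rightarrow> bool" where
  "lie_isomorphic br br' \<equiv> lie_isomorphic_onto br br' UNIV"

definition lie_derivation :: "('a::real_vector \<Rightarrow> 'a \<Rightarrow> 'a) \<Rightarrow> ('a \<Rightarrow> 'a) \<Rightarrow> bool" where
  "lie_derivation br D \<longleftrightarrow> linear D \<and> (\<forall>x y. D (br x y) = br (D x) y + br x (D y))"

section \<open>Left invariant metrics\<close>

text \<open>A Lie algebra structure \<open>br\<close> on a Euclidean space represents the simply connected Lie group
  with that Lie algebra and the left invariant metric extending the inner product \<open>\<bullet>\<close>.
  On left invariant fields the Levi-Civita connection is given by the Koszul formula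
  \<open>2 \<langle>\<nabla>\<^sub>X Y, Z\<rangle> = \<langle>[X,Y], Z\<rangle> - \<langle>[Y,Z], X\<rangle> + \<langle>[Z,X], Y\<rangle>\<close>.\<close>

definition levi_civita :: "('s::euclidean_space \<Rightarrow> 's \<Rightarrow> 's) \<Rightarrow> 's \<Rightarrow> 's \<Rightarrow> 's" where
  "levi_civita br X Y =
     (\<Sum>b\<in>Basis. ((br X Y \<bullet> b - br Y b \<bullet> X + br b X \<bullet> Y) / 2) *\<^sub>R b)"

definition riemann_curvature :: "('s::euclidean_space \<Rightarrow> 's \<Rightarrow> 's) \<Rightarrow> 's \<Rightarrow> 's \<Rightarrow> 's \<Rightarrow> 's" where
  "riemann_curvature br X Y Z =
     levi_civita br X (levi_civita br Y Z) - levi_civita br Y (levi_civita br X Z)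
       - levi_civita br (br X Y) Z"

definition ricci_tensor :: "('s::euclidean_space \<Rightarrow> 's \<Rightarrow> 's) \<Rightarrow> 's \<Rightarrow> 's \<Rightarrow> real" where
  "ricci_tensor br Y Z = (\<Sum>b\<in>Basis. riemann_curvature br b Y Z \<bullet> b)"

definition is_einstein :: "('s::euclidean_space \<Rightarrow> 's \<Rightarrow> 's) \<Rightarrow> bool" where
  "is_einstein br \<longleftrightarrow> (\<exists>c. \<forall>X Y. ricci_tensor br X Y = c * (X \<bullet> Y))"

section \<open>Einstein nilradicals\<close>

text \<open>\<open>(br, N)\<close> is the metric Lie algebra of a standard Einstein solvmanifold, together with its
  nilradical \<open>N\<close>; standard means that the orthogonal complement of \<open>N\<close> is abelian.
  (If instead the orthogonal complement of the derived algebra is required to be abelian, then so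
  is that of \<open>N\<close>, which is smaller, since the derived algebra is contained in \<open>N\<close>.)\<close>
definition standard_einstein_solvmanifold ::
  "('s::euclidean_space \<Rightarrow> 's \<Rightarrow> 's) \<Rightarrow> 's set \<Rightarrow> bool" where
  "standard_einstein_solvmanifold br N \<longleftrightarrow>
     lie_algebra br \<and> lie_solvable_on br UNIV \<and> is_nilradical br N \<and>
     (\<forall>X \<in> orthogonal_comp N. \<forall>Y \<in> orthogonal_comp N. br X Y = 0) \<and> is_einstein br"

text \<open>The solvable Lie algebra has to live on some type. Every finite-dimensional inner product
  space is, up to isometry, a Euclidean space type \<open>'s\<close>; being an Einstein nilradical means that the
  following holds for some \<open>'s\<close>, and not being one that it fails for all \<open>'s\<close>.\<close>
definition einstein_nilradical ::
  "'s::euclidean_space itself \<Rightarrow> ('a::real_vector \<Rightarrow> 'a \<Rightarrow> 'a) \<Rightarrow> bool" where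
  "einstein_nilradical (_ :: 's itself) \<mu> \<longleftrightarrow>
     (\<exists>(br :: 's \<Rightarrow> 's \<Rightarrow> 's) N. standard_einstein_solvmanifold br N \<and> lie_isomorphic_onto \<mu> br N)"

definition inner_product :: "('a::real_vector \<Rightarrow> 'a \<Rightarrow> real) \<Rightarrow> bool" where
  "inner_product ip \<longleftrightarrow> bilinear ip \<and> (\<forall>x y. ip x y = ip y x) \<and> (\<forall>x. x \<noteq> 0 \<longrightarrow> ip x x > 0)"

text \<open>\<open>R\<close> is the Ricci operator of the nilpotent Lie algebra \<open>\<mu>\<close> with inner product \<open>ip\<close>.
  The right-hand side does not depend on the orthonormal basis \<open>x\<close>.\<close>
definition is_nil_ricci_operator ::
  "(real^'n \<Rightarrow> real^'n \<Rightarrow> real^'n) \<Rightarrow> (real^'n \<Rightarrow> real^'n \<Rightarrow> real) \<Rightarrow> (real^'n \<Rightarrow> real^'n) \<Rightarrow> bool" where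
  "is_nil_ricci_operator \<mu> ip R \<longleftrightarrow>
     (\<exists>x :: 'n \<Rightarrow> real^'n. (\<forall>i j. ip (x i) (x j) = (if i = j then 1 else 0)) \<and>
       (\<forall>X Y. ip (R X) Y =
          - 1/2 * (\<Sum>i\<in>UNIV. \<Sum>j\<in>UNIV. ip (\<mu> X (x i)) (x j) * ip (\<mu> Y (x i)) (x j))
          + 1/4 * (\<Sum>i\<in>UNIV. \<Sum>j\<in>UNIV. ip (\<mu> (x i) (x j)) X * ip (\<mu> (x i) (x j)) Y)))"

text \<open>The intrinsic description of Einstein nilradicals: some inner product has
  Ricci operator \<open>c I + D\<close> with \<open>D\<close> a derivation.\<close>
definition admits_nilsoliton :: "(real^'n \<Rightarrow> real^'n \<Rightarrow> real^'n) \<Rightarrow> bool" where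
  "admits_nilsoliton \<mu> \<longleftrightarrow>
     (\<exists>ip c D. inner_product ip \<and> lie_derivation \<mu> D \<and>
        is_nil_ricci_operator \<mu> ip (\<lambda>X. c *\<^sub>R X + D X))"

section \<open>The curve of brackets\<close>

text \<open>In the index type \<open>9\<close> the numeral \<open>9\<close> equals \<open>0\<close>, so \<open>1, \<dots>, 9\<close> are its nine elements.\<close>

abbreviation e :: "9 \<Rightarrow> real^9" where
  "e i \<equiv> axis i 1"

definition wedge :: "9 \<Rightarrow> 9 \<Rightarrow> real^9 \<Rightarrow> real^9 \<Rightarrow> real" where
  "wedge i j x y = x $ i * y $ j - x $ j * y $ i"

text \<open>A summand \<open>(c * wedge i j x y) *\<^sub>R e k\<close> encodes \<open>\<mu>(e\<^sub>i, e\<^sub>j) = c e\<^sub>k\<close> and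
  \<open>\<mu>(e\<^sub>j, e\<^sub>i) = - c e\<^sub>k\<close>.\<close>
definition mu_bar :: "real \<Rightarrow> real^9 \<Rightarrow> real^9 \<Rightarrow> real^9" where
  "mu_bar t x y =
     wedge 5 4 x y *\<^sub>R e 7 + wedge 1 6 x y *\<^sub>R e 8 + wedge 3 2 x y *\<^sub>R e 9
   + (t * wedge 3 6 x y) *\<^sub>R e 7 + (t * wedge 5 2 x y) *\<^sub>R e 8 + (t * wedge 1 4 x y) *\<^sub>R e 9
   + wedge 1 2 x y *\<^sub>R e 7 + wedge 3 4 x y *\<^sub>R e 8"

end

theory Submission
  imports Defs
begin

text \<open>
The bracket pairs \<open>\<langle>e 1, e 3, e 5\<rangle>\<close> with \<open>\<langle>e 2, e 4, e 6\<rangle>\<close> and has values in the centre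
\<open>Z = \<langle>e 7, e 8, e 9\<rangle>\<close>. A functional \<open>(x, y, z)\<close> on \<open>Z\<close> turns it into a form on the quotient by
\<open>Z\<close>, whose Pfaffian \<open>(1 + t^3) x y z - t (x^3 + y^3)\<close> (up to sign) is a nodal cubic. Its node \<open>(0, 0, 1)\<close>
singles out the kernel \<open>K = \<langle>e 5, e 6\<rangle>\<close> of the form at the node, modulo \<open>Z\<close>, and the plane
\<open>P = \<langle>e 7, e 8\<rangle>\<close> of \<open>Z\<close>. Both halves of the theorem are read off from this configuration.

Nodal cubics of this shape are all equivalent, so the parameter is found in a finer invariant.
The symplectic form at the node induces an alternating form on \<open>P\<^sup>* \<otimes> K\<close>, which amounts to a quadratic
form on \<open>P\<^sup>*\<close> and one on \<open>K\<close>. The ratio of their discriminants is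
\<open>((t^3 + 1) / (t^3 - 1))^2\<close> (\<open>singular_functional\<close>, \<open>discriminant_relation\<close>), and this
determines \<open>t > 1\<close>.

For the second half, let \<open>e 1, \<dots>, e 9\<close> have the weights -1, -1, -1, -1, 2, 2, 1, 1, -2. The corresponding
one-parameter group deforms the bracket, in the limit, into the one without \<open>[e 1, e 2] = e 7\<close> and
\<open>[e 3, e 4] = e 8\<close>. So the orbit of the bracket under a suitable reductive group is not closed, while a
nilsoliton metric would make it closed. Concretely: for any metric take the
symmetric operator \<open>E\<close> with these weights and the same flag \<open>P \<subseteq> Z \<subseteq> K + Z\<close>. Derivations preserve
the flag and have trace 0 against \<open>E\<close> (\<open>derivation_entries\<close>), so the trace of \<open>Ric = c I + D\<close> against \<open>E\<close>
vanishes. By \<open>weighted_nil_ricci\<close> this trace is a positive combination of squares of the structure constants of positive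
degree, and these cannot all vanish (\<open>no_quadratic_nilsoliton\<close>).

A standard Einstein solvmanifold satisfies the nilsoliton equation on its nilradical, at least as an equation of
quadratic forms with a derivation that may fail to be symmetric. This follows from the
formula for the Ricci tensor (\<open>ricci_tensor_diagonal\<close>) once the derivations given by the complement of
the nilradical are shown to be normal on the average (\<open>nilsoliton_of_extension\<close>).
\<close>

section \<open>The brackets in coordinates\<close>

lemma exhaust_9: fixes x::9 shows "x=1\<or>x=2\<or>x=3\<or>x=4\<or>x=5\<or>x=6\<or>x=7\<or>x=8\<or>x=9"
proof (induct x)
  case (of_int z)
  then have "0 \<le> z" and "z < 9" by simp_all
  then have "z = 0 | z = 1 | z = 2 | z = 3| z = 4| z = 5| z = 6| z = 7| z = 8" by arith
  then show ?case by auto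
qed

lemma forall_9: "(\<forall>i::9. P i) \<longleftrightarrow> P 1 \<and> P 2 \<and> P 3 \<and> P 4 \<and> P 5 \<and> P 6 \<and> P 7 \<and> P 8 \<and> P 9"
  by (metis exhaust_9)

lemma UNIV_9: "(UNIV::9 set) = {1,2,3,4,5,6,7,8,9}" using exhaust_9 by auto

lemma sum_9: "(\<Sum>i\<in>(UNIV::9 set). f i) = f 1+f 2+f 3+f 4+f 5+f 6+f 7+f 8+f 9"
  unfolding UNIV_9 by (simp add: add.assoc)

lemma nth_e: "e i $ j = (if j = i then 1 else 0)"
  by (simp add: axis_def)

lemma mu_bar_nth [simp]:
  "mu_bar t x y $ 1 = 0" "mu_bar t x y $ 2 = 0" "mu_bar t x y $ 3 = 0"
  "mu_bar t x y $ 4 = 0" "mu_bar t x y $ 5 = 0" "mu_bar t x y $ 6 = 0"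
  "mu_bar t x y $ 7 = wedge 5 4 x y + t * wedge 3 6 x y + wedge 1 2 x y"
  "mu_bar t x y $ 8 = wedge 1 6 x y + t * wedge 5 2 x y + wedge 3 4 x y"
  "mu_bar t x y $ 9 = wedge 3 2 x y + t * wedge 1 4 x y"
  by (simp_all add: mu_bar_def axis_def)

lemma vec9_eq_iff: "x = y \<longleftrightarrow> x $ 1 = y $ 1 \<and> x $ 2 = y $ 2 \<and> x $ 3 = y $ 3 \<and> x $ 4 = y $ 4 \<and> x $ 5 = y $ 5
   \<and> x $ 6 = y $ 6 \<and> x $ 7 = y $ 7 \<and> x $ 8 = y $ 8 \<and> x $ 9 = y $ 9" for x y :: "'a^9"
  unfolding vec_eq_iff forall_9 ..

lemma bilinear_mu_bar: "bilinear (mu_bar t)"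
  unfolding bilinear_def linear_iff
  by (simp add: vec9_eq_iff wedge_def algebra_simps)

lemma mu_bar_skew: "mu_bar t x y = - mu_bar t y x"
  by (simp add: vec9_eq_iff wedge_def algebra_simps)

lemma mu_bar_two_step: "mu_bar t x (mu_bar t y z) = 0"
  by (simp add: vec9_eq_iff wedge_def)

lemma lie_algebra_mu_bar: "lie_algebra (mu_bar t)"
  unfolding lie_algebra_def
  by (simp add: bilinear_mu_bar mu_bar_two_step) (simp add: vec9_eq_iff wedge_def)

lemma nilpotent_mu_bar: "lie_nilpotent_on (mu_bar t) UNIV"
proof -
  have *: "bracket_span (mu_bar t) UNIV UNIV \<subseteq> {z. \<forall>x. mu_bar t x z = 0}"
    unfolding bracket_span_def
  proof (rule span_minimal)
    show "subspace {z. \<forall>x. mu_bar t x z = 0}"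
      using bilinear_mu_bar[of t] unfolding subspace_def
      by (auto simp: bilinear_radd bilinear_rmul bilinear_rzero)
  qed (auto simp: mu_bar_two_step)
  have "{mu_bar t x y |x y. x \<in> UNIV \<and> y \<in> bracket_span (mu_bar t) UNIV UNIV} \<subseteq> {0}"
    using * by blast
  then have "lower_central (mu_bar t) UNIV 2 \<subseteq> {0}"
    unfolding numeral_2_eq_2 lower_central.simps bracket_span_def[of _ _ "bracket_span _ _ _"]
    by (rule span_minimal) (rule subspace_single_0)
  moreover have "0 \<in> lower_central (mu_bar t) UNIV 2"
    by (simp add: numeral_2_eq_2 bracket_span_def span_zero)
  ultimately have "lower_central (mu_bar t) UNIV 2 = {0}" by blast
  then show ?thesis unfolding lie_nilpotent_on_def by blast
qed

section \<open>The node of the Pfaffian cubic\<close>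

lemma linear_functional_9:
  assumes "linear f" shows "f (x::real^9) = (\<Sum>i\<in>UNIV. x $ i * f (e i) :: real)"
proof -
  have "f x = f (\<Sum>i\<in>UNIV. (x $ i) *\<^sub>R e i)" by (simp add: basis_expansion flip: scalar_mult_eq_scaleR)
  also have "\<dots> = (\<Sum>i\<in>UNIV. x $ i * f (e i))"
    by (simp add: linear_sum[OF assms] linear_cmul[OF assms])
  finally show ?thesis .
qed

lemma linear_mu_bar:
  assumes "linear f"
  shows "f (mu_bar t x y) = (wedge 5 4 x y + t * wedge 3 6 x y + wedge 1 2 x y) * f (e 7)
    + (wedge 1 6 x y + t * wedge 5 2 x y + wedge 3 4 x y) * f (e 8) + (wedge 3 2 x y + t * wedge 1 4 x y) * (f (e 9)::real)"
  by (subst linear_functional_9[OF assms]) (simp add: sum_9)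

text \<open>The form \<open>f \<circ> mu_bar t\<close> pairs odd with even coordinates. With rows 1, 3, 5 and columns 2, 4, 6 its matrix
is \<open>((x, t z, y), (z, y, t x), (t y, x, 0))\<close>, whose determinant \<open>(1 + t^3) x y z - t (x^3 + y^3)\<close> is
up to sign the Pfaffian of the form. The equations describe the left kernel in the odd coordinates of \<open>u\<close> and the
right kernel in the even ones.\<close>
lemma kernel_equations:
  assumes "linear f" and "\<And>y. f (mu_bar t u y) = (0::real)"
    and "x = f (e 7)" "y = f (e 8)" "z = f (e 9)"
  shows "x * u $ 1 + z * u $ 3 + t * y * u $ 5 = 0" "t * z * u $ 1 + y * u $ 3 + x * u $ 5 = 0"
    "y * u $ 1 + t * x * u $ 3 = 0" "x * u $ 2 + t * z * u $ 4 + y * u $ 6 = 0"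
    "z * u $ 2 + y * u $ 4 + t * x * u $ 6 = 0" "t * y * u $ 2 + x * u $ 4 = 0"
  using assms(2)[of "e 1"] assms(2)[of "e 2"] assms(2)[of "e 3"]
    assms(2)[of "e 4"] assms(2)[of "e 5"] assms(2)[of "e 6"]
  unfolding linear_mu_bar[OF assms(1)] assms(3-5) by (simp_all add: wedge_def axis_def algebra_simps)

lemma mu_bar_central:
  assumes "u $ 1 = 0" "u $ 2 = 0" "u $ 3 = 0" "u $ 4 = 0" "u $ 5 = 0" "u $ 6 = 0"
  shows "mu_bar t u y = 0"
  using assms by (simp add: vec9_eq_iff wedge_def)

text \<open>At a functional whose form has a two-dimensional kernel \<open>\<langle>u, v\<rangle>\<close>, the derivative of the Pfaffian in a
direction \<open>f'\<close> is a nonzero multiple of \<open>f' (mu_bar t u v)\<close>. So commuting kernel vectors belong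
to a singular point of the cubic, and its only singular point is the node \<open>x = y = 0\<close>. The proof
solves the kernel equations in terms of two coordinates and reads the components of
\<open>mu_bar t u v\<close> as partial derivatives.\<close>
lemma singular_functional:
  fixes t :: real
  assumes t: "t > 0" and f: "linear f"
    and u: "\<And>y. f (mu_bar t u y) = (0::real)" and v: "\<And>y. f (mu_bar t v y) = 0"
    and uv: "mu_bar t u v = 0"
    and indep: "\<And>c d. (\<And>y. mu_bar t (c *\<^sub>R u + d *\<^sub>R v) y = 0) \<Longrightarrow> c = 0 \<and> d = 0"
  shows "f (e 7) = 0" "f (e 8) = 0"
proof -
  define x y z where xyz: "x = f (e 7)" "y = f (e 8)" "z = f (e 9)"
  note eu = kernel_equations[OF f u xyz] and ev = kernel_equations[OF f v xyz]
  have indep': "c = 0 \<and> d = 0"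
    if "\<And>i. i \<in> {1,2,3,4,5,6} \<Longrightarrow> c * u $ i + d * v $ i = 0" for c d
    by (rule indep, rule mu_bar_central) (use that in simp_all)
  have comp7: "wedge 5 4 u v + t * wedge 3 6 u v + wedge 1 2 u v = 0"
    and comp8: "wedge 1 6 u v + t * wedge 5 2 u v + wedge 3 4 u v = 0"
    and comp9: "wedge 3 2 u v + t * wedge 1 4 u v = 0"
    using uv unfolding vec9_eq_iff by simp_all
  have "x = 0 \<and> y = 0"
  proof (cases "x = 0")
    case x: False
    \<comment> \<open>A kernel vector is determined by its first two coordinates.\<close>
    have k: "w $ 3 = - (y / (t * x)) * w $ 1" "w $ 4 = - (t * y / x) * w $ 2"
        "w $ 5 = ((y * y / (t * x) - t * z) / x) * w $ 1"
        "w $ 6 = ((t * y * y / x - z) / (t * x)) * w $ 2"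
      if w: "t * z * w $ 1 + y * w $ 3 + x * w $ 5 = 0" "y * w $ 1 + t * x * w $ 3 = 0"
        "z * w $ 2 + y * w $ 4 + t * x * w $ 6 = 0" "t * y * w $ 2 + x * w $ 4 = 0" for w :: "real^9"
    proof -
      show 3: "w $ 3 = - (y / (t * x)) * w $ 1" using w(2) x t by (simp add: field_simps)
      show 4: "w $ 4 = - (t * y / x) * w $ 2" using w(4) x t by (simp add: field_simps)
      show "w $ 5 = ((y * y / (t * x) - t * z) / x) * w $ 1"
        using w(1) x t unfolding 3 by (simp add: field_simps)
      show "w $ 6 = ((t * y * y / x - z) / (t * x)) * w $ 2"
        using w(3) x t unfolding 4 by (simp add: field_simps)
    qed
    note ku = k[OF eu(2,3,5,6)] and kv = k[OF ev(2,3,5,6)]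
    define \<delta> where "\<delta> = wedge 1 2 u v"
    have d: "\<delta> = u $ 1 * v $ 2 - u $ 2 * v $ 1" by (simp add: \<delta>_def wedge_def)
    have "\<delta> \<noteq> 0"
    proof
      assume "\<delta> = 0"
      then have *: "u $ 1 * v $ 2 = u $ 2 * v $ 1" unfolding d by simp
      have "v $ 1 = 0 \<and> - u $ 1 = 0"
        by (rule indep') (use * in \<open>auto simp: ku kv algebra_simps\<close>)
      moreover have "v $ 2 = 0 \<and> - u $ 2 = 0"
        by (rule indep') (use * in \<open>auto simp: ku kv algebra_simps\<close>)
      ultimately have "(1::real) = 0 \<and> (0::real) = 0"
        by (intro indep') (auto simp: ku kv)
      then show False by simp
    qed
    have "wedge 3 2 u v + t * wedge 1 4 u v = - (y * (1 + t ^ 3) / (t * x)) * \<delta>"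
      unfolding wedge_def ku kv d using x t by (simp add: field_simps power3_eq_cube)
    then have "y * (1 + t ^ 3) / (t * x) = 0" using comp9 \<open>\<delta> \<noteq> 0\<close> by simp
    moreover have "1 + t ^ 3 > 0" using t by (simp add: add_pos_pos)
    ultimately have "y = 0" using x t by simp
    then have "wedge 5 4 u v + t * wedge 3 6 u v + wedge 1 2 u v = \<delta>"
      unfolding wedge_def ku kv d by simp
    then show ?thesis using comp7 \<open>\<delta> \<noteq> 0\<close> by simp
  next
    case x: True
    show ?thesis
    proof (cases "y = 0")
      case y: False
      have k: "w $ 1 = 0" "w $ 2 = 0" "w $ 5 = - (z / (t * y)) * w $ 3" "w $ 6 = - (t * z / y) * w $ 4"
        if w: "x * w $ 1 + z * w $ 3 + t * y * w $ 5 = 0" "y * w $ 1 + t * x * w $ 3 = 0"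
          "x * w $ 2 + t * z * w $ 4 + y * w $ 6 = 0" "t * y * w $ 2 + x * w $ 4 = 0" for w :: "real^9"
        using w x y t by (simp_all add: field_simps)
      note ku = k[OF eu(1,3,4,6)] and kv = k[OF ev(1,3,4,6)]
      have *: "u $ 3 * v $ 4 - u $ 4 * v $ 3 = 0"
        using comp8 by (simp add: wedge_def ku kv)
      have "v $ 3 = 0 \<and> - u $ 3 = 0"
        by (rule indep') (use * in \<open>auto simp: ku kv algebra_simps\<close>)
      moreover have "v $ 4 = 0 \<and> - u $ 4 = 0"
        by (rule indep') (use * in \<open>auto simp: ku kv algebra_simps\<close>)
      ultimately have "(1::real) = 0 \<and> (0::real) = 0"
        by (intro indep') (auto simp: ku kv)
      then show ?thesis by simp
    qed (use x in simp)
  qed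
  then show "f (e 7) = 0" "f (e 8) = 0" by (simp_all add: xyz)
qed

text \<open>At the node, \<open>f\<close> induces a symplectic form \<open>\<omega>\<close> on the quotient of the whole space by the kernel
\<open>\<langle>u, v\<rangle>\<close> and the centre. The vector \<open>au\<close> represents the linear form \<open>\<alpha> (mu_bar t u _)\<close> with respect to
\<open>\<omega>\<close>, and likewise for \<open>bu\<close>, \<open>av\<close>, \<open>bv\<close>. This makes \<open>\<omega>\<close> an alternating form on the tensor product
of \<open>\<langle>\<alpha>, \<beta>\<rangle>\<close> and \<open>\<langle>u, v\<rangle>\<close>, that is, a pair of binary quadratic forms: one on \<open>\<langle>\<alpha>, \<beta>\<rangle>\<close>, one on
\<open>\<langle>u, v\<rangle>\<close>. Under changes of bases their discriminants scale by the same factor, so the ratio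
\<open>((t^3 + 1) / (t^3 - 1))^2\<close> is an isomorphism invariant of the Lie algebra.\<close>
lemma discriminant_relation:
  fixes t :: real
  assumes t: "t > 0" and f: "linear f" and \<alpha>: "linear \<alpha>" and \<beta>: "linear \<beta>"
    and nz: "f (mu_bar t x\<^sub>0 y\<^sub>0) \<noteq> (0::real)"
    and u: "\<And>y. f (mu_bar t u y) = (0::real)" and v: "\<And>y. f (mu_bar t v y) = 0"
    and uv: "mu_bar t u v = 0"
    and indep: "\<And>c d. (\<And>y. mu_bar t (c *\<^sub>R u + d *\<^sub>R v) y = 0) \<Longrightarrow> c = 0 \<and> d = 0"
    and au: "\<And>y. f (mu_bar t au y) = \<alpha> (mu_bar t u y)"
    and bu: "\<And>y. f (mu_bar t bu y) = \<beta> (mu_bar t u y)"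
    and av: "\<And>y. f (mu_bar t av y) = \<alpha> (mu_bar t v y)"
    and bv: "\<And>y. f (mu_bar t bv y) = \<beta> (mu_bar t v y)"
  defines "\<omega> \<equiv> \<lambda>x y. f (mu_bar t x y)"
  shows "(t^3 - 1)\<^sup>2 * ((\<omega> au bv + \<omega> bu av)\<^sup>2 - 4 * \<omega> au av * \<omega> bu bv)
    = (t^3 + 1)\<^sup>2 * ((\<omega> au bv + \<omega> av bu)\<^sup>2 - 4 * \<omega> au bu * \<omega> av bv)"
proof -
  have sing: "f (e 7) = 0" "f (e 8) = 0"
    by (rule singular_functional[OF t f u v uv], rule indep, assumption)+
  define z where "z = f (e 9)"
  have \<omega>: "\<omega> x y = z * (wedge 3 2 x y + t * wedge 1 4 x y)" for x y
    unfolding \<omega>_def linear_mu_bar[OF f] sing z_def by simp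
  have z: "z \<noteq> 0" using nz \<omega>[of x\<^sub>0 y\<^sub>0] unfolding \<omega>_def by auto
  have ker: "w $ 1 = 0" "w $ 2 = 0" "w $ 3 = 0" "w $ 4 = 0" if w: "\<And>y. f (mu_bar t w y) = 0" for w
    using kernel_equations[OF f w refl refl refl] z t unfolding sing z_def[symmetric] by simp_all
  \<comment> \<open>Solving \<open>\<omega> p _ = g (mu_bar t w _)\<close> for \<open>p\<close>, where \<open>w\<close> lies in the kernel of \<open>\<omega>\<close>.\<close>
  have ham: "p $ 1 = g (e 7) * w $ 5 / (t * z)" "p $ 2 = t * g (e 7) * w $ 6 / z"
      "p $ 3 = t * g (e 8) * w $ 5 / z" "p $ 4 = g (e 8) * w $ 6 / (t * z)"
    if w: "\<And>y. f (mu_bar t w y) = 0" and p: "\<And>y. f (mu_bar t p y) = g (mu_bar t w y)"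
      and g: "linear g" for p w and g :: "real^9 \<Rightarrow> real"
  proof -
    have *: "z * (wedge 3 2 p y + t * wedge 1 4 p y) = (w $ 5 * y $ 4 - t * w $ 6 * y $ 3) * g (e 7)
      + (t * w $ 5 * y $ 2 - w $ 6 * y $ 1) * g (e 8)" for y
      using p[of y] \<omega>[of p y] ker[OF w] unfolding \<omega>_def linear_mu_bar[OF g] by (simp add: wedge_def algebra_simps)
    show "p $ 1 = g (e 7) * w $ 5 / (t * z)" "p $ 2 = t * g (e 7) * w $ 6 / z"
      "p $ 3 = t * g (e 8) * w $ 5 / z" "p $ 4 = g (e 8) * w $ 6 / (t * z)"
      using *[of "e 4"] *[of "e 3"] *[of "e 2"] *[of "e 1"] z t
      by (simp_all add: wedge_def axis_def field_simps)
  qed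
  define \<delta> where "\<delta> = \<alpha> (e 7) * \<beta> (e 8) - \<alpha> (e 8) * \<beta> (e 7)"
  define \<epsilon> where "\<epsilon> = u $ 5 * v $ 6 - u $ 6 * v $ 5"
  have \<omega>': "\<omega> p q = (t^2 * (g (e 8) * h (e 7) * w $ 5 * r $ 6 - g (e 7) * h (e 8) * w $ 6 * r $ 5)
      + (g (e 7) * h (e 8) * w $ 5 * r $ 6 - g (e 8) * h (e 7) * w $ 6 * r $ 5) / t) / z"
    if w: "\<And>y. f (mu_bar t w y) = 0" and p: "\<And>y. f (mu_bar t p y) = g (mu_bar t w y)"
      and g: "linear g"
    and r: "\<And>y. f (mu_bar t r y) = 0" and q: "\<And>y. f (mu_bar t q y) = h (mu_bar t r y)"
      and h: "linear h" for p w q r and g h :: "real^9 \<Rightarrow> real"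
    unfolding \<omega> wedge_def ham[OF w p g] ham[OF r q h] using z t 
    by (simp add: field_simps power2_eq_square)
  have 1: "\<omega> au bv = (t^2 * (\<alpha> (e 8) * \<beta> (e 7) * u $ 5 * v $ 6 - \<alpha> (e 7) * \<beta> (e 8) * u $ 6 * v $ 5)
      + (\<alpha> (e 7) * \<beta> (e 8) * u $ 5 * v $ 6 - \<alpha> (e 8) * \<beta> (e 7) * u $ 6 * v $ 5) / t) / z"
    by (rule \<omega>'[OF u au \<alpha> v bv \<beta>])
  have 2: "\<omega> bu av = (t^2 * (\<beta> (e 8) * \<alpha> (e 7) * u $ 5 * v $ 6 - \<beta> (e 7) * \<alpha> (e 8) * u $ 6 * v $ 5)
      + (\<beta> (e 7) * \<alpha> (e 8) * u $ 5 * v $ 6 - \<beta> (e 8) * \<alpha> (e 7) * u $ 6 * v $ 5) / t) / z"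
    by (rule \<omega>'[OF u bu \<beta> v av \<alpha>])
  have skew: "\<omega> av bu = - \<omega> bu av" unfolding \<omega> wedge_def by (simp add: algebra_simps)
  have 3: "\<omega> au av = (t^2 + 1/t) * \<alpha> (e 7) * \<alpha> (e 8) * \<epsilon> / z"
    unfolding \<omega>'[OF u au \<alpha> v av \<alpha>] \<epsilon>_def using z t by (simp add: field_simps)
  have 4: "\<omega> bu bv = (t^2 + 1/t) * \<beta> (e 7) * \<beta> (e 8) * \<epsilon> / z"
    unfolding \<omega>'[OF u bu \<beta> v bv \<beta>] \<epsilon>_def using z t by (simp add: field_simps)
  have 5: "\<omega> au bu = (1/t - t^2) * u $ 5 * u $ 6 * \<delta> / z"
    unfolding \<omega>'[OF u au \<alpha> u bu \<beta>] \<delta>_def using z t by (simp add: field_simps)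
  have 6: "\<omega> av bv = (1/t - t^2) * v $ 5 * v $ 6 * \<delta> / z"
    unfolding \<omega>'[OF v av \<alpha> v bv \<beta>] \<delta>_def using z t by (simp add: field_simps)
  have 7: "\<omega> au bv + \<omega> bu av = (t^2 + 1/t) * (\<alpha> (e 7) * \<beta> (e 8) + \<alpha> (e 8) * \<beta> (e 7)) * \<epsilon> / z"
    unfolding 1 2 \<epsilon>_def using z t by (simp add: field_simps)
  have 8: "\<omega> au bv + \<omega> av bu = (1/t - t^2) * (u $ 5 * v $ 6 + u $ 6 * v $ 5) * \<delta> / z"
    unfolding skew 1 2 \<delta>_def using z t by (simp add: field_simps)
  have L: "(\<omega> au bv + \<omega> bu av)\<^sup>2 - 4 * \<omega> au av * \<omega> bu bv = ((t^2 + 1/t) * \<delta> * \<epsilon> / z)\<^sup>2"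
    unfolding 3 4 7 \<delta>_def using z by (simp add: power2_eq_square field_simps)
  have R: "(\<omega> au bv + \<omega> av bu)\<^sup>2 - 4 * \<omega> au bu * \<omega> av bv = ((1/t - t^2) * \<delta> * \<epsilon> / z)\<^sup>2"
    unfolding 5 6 8 \<epsilon>_def using z by (simp add: power2_eq_square field_simps)
  have "(t^3 - 1) * (t^2 + 1/t) = - ((t^3 + 1) * (1/t - t^2))"
    using t by (simp add: field_simps power2_eq_square power3_eq_cube)
  then have "(t^3 - 1)\<^sup>2 * (t^2 + 1/t)\<^sup>2 = (t^3 + 1)\<^sup>2 * (1/t - t^2)\<^sup>2"
    by (metis power2_minus power_mult_distrib)
  then show ?thesis unfolding L R by (simp add: power_mult_distrib power_divide)
qed

text \<open>All data of the discriminant relation are transported along an isomorphism. In the source they are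
\<open>u = e 5\<close>, \<open>v = e 6\<close>, the coordinates 9, 7, 8 for \<open>f\<close>, \<open>\<alpha>\<close>, \<open>\<beta>\<close>, and the representing vectors
\<open>e 1 / t\<close>, \<open>t e 3\<close>, \<open>t e 2\<close>, \<open>e 4 / t\<close>; since \<open>x \<mapsto> (x + 1) / (x - 1)\<close> is injective and positive
for \<open>x > 1\<close>, the ratio determines \<open>t^3\<close>.\<close>
lemma not_isomorphic:
  assumes t: "t > 1" and s: "s > 1" and ne: "t \<noteq> s"
  shows "\<not> lie_isomorphic (mu_bar t) (mu_bar s)"
proof
  assume "lie_isomorphic (mu_bar t) (mu_bar s)"
  then obtain \<phi> where lin: "linear \<phi>" and bij: "bij \<phi>" and hom: "\<And>x y. \<phi> (mu_bar t x y) = mu_bar s (\<phi> x) (\<phi> y)"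
    unfolding lie_isomorphic_onto_def by blast
  define \<psi> where "\<psi> = inv \<phi>"
  have \<phi>\<psi>: "\<phi> (\<psi> x) = x" and \<psi>\<phi>: "\<psi> (\<phi> x) = x" for x
    using bij by (simp_all add: \<psi>_def bij_is_surj surj_f_inv_f bij_is_inj)
  have lin\<psi>: "linear \<psi>"
    unfolding \<psi>_def using inj_linear_imp_inv_linear[OF lin bij_is_inj[OF bij]] .
  have hom\<psi>: "\<psi> (mu_bar s (\<phi> x) y) = mu_bar t x (\<psi> y)" for x y
    by (metis hom \<phi>\<psi> \<psi>\<phi>)
  have coord: "linear (\<lambda>y. \<psi> y $ i)" for i
    by (rule linearI) (simp_all add: linear_add[OF lin\<psi>] linear_cmul[OF lin\<psi>])
  note m = hom\<psi> wedge_def axis_def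
  have rel: "(s^3 - 1)\<^sup>2 * ((1 / t + t^2)\<^sup>2) = (s^3 + 1)\<^sup>2 * ((1 / t - t^2)\<^sup>2)"
  proof -
    define \<omega> where "\<omega> x y = \<psi> (mu_bar s x y) $ 9" for x y
    have \<omega>: "\<omega> (\<phi> x) (\<phi> y) = mu_bar t x y $ 9" for x y unfolding \<omega>_def hom\<psi> \<psi>\<phi> ..
    have "(s^3 - 1)\<^sup>2 * ((\<omega> (\<phi> ((1/t) *\<^sub>R e 1)) (\<phi> ((1/t) *\<^sub>R e 4)) + \<omega> (\<phi> (t *\<^sub>R e 3)) (\<phi> (t *\<^sub>R e 2)))\<^sup>2
        - 4 * \<omega> (\<phi> ((1/t) *\<^sub>R e 1)) (\<phi> (t *\<^sub>R e 2)) * \<omega> (\<phi> (t *\<^sub>R e 3)) (\<phi> ((1/t) *\<^sub>R e 4)))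
      = (s^3 + 1)\<^sup>2 * ((\<omega> (\<phi> ((1/t) *\<^sub>R e 1)) (\<phi> ((1/t) *\<^sub>R e 4)) + \<omega> (\<phi> (t *\<^sub>R e 2)) (\<phi> (t *\<^sub>R e 3)))\<^sup>2
        - 4 * \<omega> (\<phi> ((1/t) *\<^sub>R e 1)) (\<phi> (t *\<^sub>R e 3)) * \<omega> (\<phi> (t *\<^sub>R e 2)) (\<phi> ((1/t) *\<^sub>R e 4)))"
      unfolding \<omega>_def
    proof (rule discriminant_relation[OF _ coord[of 9] coord[of 7] coord[of 8], where u = "\<phi> (e 5)" and v = "\<phi> (e 6)"])
      show "s > 0" using s by simp
      show "\<psi> (mu_bar s (\<phi> (e 3)) (\<phi> (e 2))) $ 9 \<noteq> 0" unfolding hom\<psi> \<psi>\<phi> by (simp add: wedge_def axis_def)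
      show "mu_bar s (\<phi> (e 5)) (\<phi> (e 6)) = 0"
      proof -
        have "mu_bar t (e 5) (e 6) = 0" by (simp add: vec9_eq_iff wedge_def axis_def)
        then show ?thesis using hom[of "e 5" "e 6"] linear_0[OF lin] by simp
      qed
    next
      fix c d assume *: "\<And>y. mu_bar s (c *\<^sub>R \<phi> (e 5) + d *\<^sub>R \<phi> (e 6)) y = 0"
      have "\<phi> (mu_bar t (c *\<^sub>R e 5 + d *\<^sub>R e 6) y) = 0" for y
        by (simp add: hom linear_add[OF lin] linear_cmul[OF lin] *)
      then have **: "mu_bar t (c *\<^sub>R e 5 + d *\<^sub>R e 6) y = 0" for y
        by (metis \<psi>\<phi> linear_0 lin\<psi>)
      have "mu_bar t (c *\<^sub>R e 5 + d *\<^sub>R e 6) (e 4) $ 7 = 0" "mu_bar t (c *\<^sub>R e 5 + d *\<^sub>R e 6) (e 1) $ 8 = 0"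
        unfolding ** by simp_all
      then show "c = 0 \<and> d = 0" by (simp add: wedge_def axis_def)
    qed (use t in \<open>simp_all add: m\<close>)
    then show ?thesis unfolding \<omega> using t by (simp add: wedge_def axis_def power2_eq_square)
  qed
  define p q where "p = t^3" and "q = s^3"
  have pq: "p > 1" "q > 1" unfolding p_def q_def using t s one_less_power by auto
  have frac: "1 / t + t^2 = (p + 1) / t" "1 / t - t^2 = - ((p - 1) / t)"
    using t by (simp_all add: p_def field_simps power2_eq_square power3_eq_cube)
  have "(q - 1)\<^sup>2 * (p + 1)\<^sup>2 = (q + 1)\<^sup>2 * (p - 1)\<^sup>2"
    using rel[folded q_def] t unfolding frac by (simp add: power_divide)
  then have "((q - 1) * (p + 1))\<^sup>2 = ((q + 1) * (p - 1))\<^sup>2"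
    by (simp only: power_mult_distrib)
  then have "(q - 1) * (p + 1) = (q + 1) * (p - 1)"
    by (rule power2_eq_imp_eq) (use pq in simp_all)
  then have "p = q" by (simp add: algebra_simps)
  then have "t = s" using t s power_eq_imp_eq_base[of t 3 s] unfolding p_def q_def by simp
  then show False using ne by simp
qed

section \<open>Derivations\<close>

lemma mu_bar_basis:
  "mu_bar t (e 5) (e 4) = e 7" "mu_bar t (e 1) (e 6) = e 8" "mu_bar t (e 3) (e 2) = e 9"
  "mu_bar t (e 3) (e 6) = t *\<^sub>R e 7" "mu_bar t (e 5) (e 2) = t *\<^sub>R e 8" "mu_bar t (e 1) (e 4) = t *\<^sub>R e 9"
  "mu_bar t (e 1) (e 2) = e 7" "mu_bar t (e 3) (e 4) = e 8"
  "mu_bar t (e 5) (e 6) = 0" "mu_bar t (e 1) (e 5) = 0" "mu_bar t (e 3) (e 5) = 0"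
  "mu_bar t (e 2) (e 6) = 0" "mu_bar t (e 4) (e 6) = 0"
  by (simp_all add: vec9_eq_iff wedge_def nth_e)

text \<open>The bracket of two basis vectors is a multiple of a basis vector, and the nonzero brackets of a fixed
basis vector with the others are linearly independent. Hence the diagonal of a derivation is itself a
derivation, and the eight brackets leave only the diagonals of the form \<open>a\<close> on \<open>e 1, e 3, e 5\<close>, \<open>b\<close> on
\<open>e 2, e 4, e 6\<close>, \<open>a + b\<close> on \<open>e 7, e 8, e 9\<close>. Off the diagonal, the flag
\<open>\<langle>e 7, e 8\<rangle> \<subseteq> \<langle>e 7, e 8, e 9\<rangle> \<subseteq> \<langle>e 5, \<dots>, e 9\<rangle>\<close> attached to the node is preserved.\<close>
lemma derivation_entries:
  assumes t: "t > 0" and D: "linear D" and der: "\<And>x y. D (mu_bar t x y) = mu_bar t (D x) y + mu_bar t x (D y)"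
  shows derivation_diagonal:
    "D (e 3) $ 3 = D (e 1) $ 1" "D (e 5) $ 5 = D (e 1) $ 1"
    "D (e 4) $ 4 = D (e 2) $ 2" "D (e 6) $ 6 = D (e 2) $ 2"
    "D (e 7) $ 7 = D (e 1) $ 1 + D (e 2) $ 2" "D (e 8) $ 8 = D (e 1) $ 1 + D (e 2) $ 2"
    "D (e 9) $ 9 = D (e 1) $ 1 + D (e 2) $ 2"
  and derivation_kernel:
    "\<And>i j. i \<in> {1,2,3,4} \<Longrightarrow> j \<in> {5,6} \<Longrightarrow> D (e j) $ i = 0"
  and derivation_image: "D (e 7) $ 9 = 0" "D (e 8) $ 9 = 0"
  and derivation_center: "\<And>i j. i \<in> {1,2,3,4,5,6} \<Longrightarrow> j \<in> {7,8,9} \<Longrightarrow> D (e j) $ i = 0"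
proof -
  define d where "d i j = D (e j) $ i" for i j
  have eq: "D (mu_bar t (e i) (e j)) $ k = mu_bar t (D (e i)) (e j) $ k + mu_bar t (e i) (D (e j)) $ k" for i j k
    unfolding der by simp
  note mb = mu_bar_basis linear_0[OF D] linear_cmul[OF D] vector_scaleR_component real_scaleR_def zero_index
  note eqs = eq[of 5 4, unfolded mb] eq[of 1 6, unfolded mb] eq[of 3 2, unfolded mb] eq[of 3 6, unfolded mb]
    eq[of 5 2, unfolded mb] eq[of 1 4, unfolded mb] eq[of 1 2, unfolded mb] eq[of 3 4, unfolded mb]
    eq[of 5 6, unfolded mb] eq[of 1 5, unfolded mb] eq[of 3 5, unfolded mb] eq[of 2 6, unfolded mb] eq[of 4 6, unfolded mb]
  note w = wedge_def nth_e d_def[symmetric]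
  have diag1: "d 7 7 = d 5 5 + d 4 4" "d 8 8 = d 1 1 + d 6 6" "d 9 9 = d 3 3 + d 2 2"
    "d 7 7 = d 1 1 + d 2 2" "d 8 8 = d 3 3 + d 4 4"
    using eqs(1)[of 7] eqs(2)[of 8] eqs(3)[of 9] eqs(7)[of 7] eqs(8)[of 8]
    unfolding mu_bar_nth by (simp_all add: w)
  have diagt: "t * d 7 7 = t * (d 3 3 + d 6 6)" "t * d 8 8 = t * (d 5 5 + d 2 2)" "t * d 9 9 = t * (d 1 1 + d 4 4)"
    using eqs(4)[of 7] eqs(5)[of 8] eqs(6)[of 9] unfolding mu_bar_nth by (simp_all add: w distrib_left)
  note diag = diag1 diagt[unfolded mult_left_cancel[OF less_imp_neq[OF t, symmetric]]]
  have z: "d 2 5 = 0" "d 4 5 = 0" "d 3 6 = 0" "d 1 6 = 0"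
    using eqs(11)[of 9] eqs(10)[of 9] eqs(12)[of 9] eqs(13)[of 9] t unfolding mu_bar_nth by (simp_all add: w)
  have o: "d 1 5 + t * d 2 6 = 0" "t * d 3 5 + d 4 6 = 0" "t * d 9 8 = d 3 5" "d 9 7 = t * d 1 5"
      "d 9 8 = t * d 4 6" "t * d 9 7 = d 2 6"
    using eqs(9)[of 8] eqs(9)[of 7] eqs(5)[of 9] eqs(1)[of 9] eqs(2)[of 9] eqs(4)[of 9]
    unfolding mu_bar_nth by (simp_all add: w)
  have "1 + t ^ 3 > 0" using t by (simp add: add_pos_pos)
  have "(1 + t ^ 3) * d 1 5 = 0" using o(1,4,6) by (simp add: algebra_simps power3_eq_cube)
  then have 15: "d 1 5 = 0" using \<open>1 + t ^ 3 > 0\<close> by auto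
  have "(1 + t ^ 3) * d 4 6 = 0" using o(2,3,5) by (simp add: algebra_simps power3_eq_cube)
  then have 46: "d 4 6 = 0" using \<open>1 + t ^ 3 > 0\<close> by auto
  show "D (e 3) $ 3 = D (e 1) $ 1" "D (e 5) $ 5 = D (e 1) $ 1"
    "D (e 4) $ 4 = D (e 2) $ 2" "D (e 6) $ 6 = D (e 2) $ 2"
    "D (e 7) $ 7 = D (e 1) $ 1 + D (e 2) $ 2" "D (e 8) $ 8 = D (e 1) $ 1 + D (e 2) $ 2"
    "D (e 9) $ 9 = D (e 1) $ 1 + D (e 2) $ 2"
    using diag unfolding d_def by linarith+
  show 97: "D (e 7) $ 9 = 0" and 98: "D (e 8) $ 9 = 0"
    using o(4,5) 15 46 by (simp_all add: d_def)
  show "D (e j) $ i = 0" if "i \<in> {1,2,3,4}" "j \<in> {5,6}" for i j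
    using that z o 15 46 97 98 t by (auto simp: d_def)
  show "D (e j) $ i = 0" if "i \<in> {1,2,3,4,5,6}" "j \<in> {7,8,9}" for i j
    using that eqs(7)[of i] eqs(8)[of i] eqs(3)[of i] by auto
qed

section \<open>Traces and orthonormal bases\<close>

lemma bilinear_inner: "bilinear (\<lambda>x y. f x \<bullet> g y)" if "linear f" "linear g"
  using that unfolding bilinear_def linear_iff by (simp add: inner_left_distrib inner_right_distrib)

definition orthonormal :: "'a::euclidean_space set \<Rightarrow> bool" where
  "orthonormal B \<longleftrightarrow> finite B \<and> (\<forall>b\<in>B. \<forall>b'\<in>B. b \<bullet> b' = (if b = b' then 1 else 0))"

lemma orthonormal_Basis: "orthonormal Basis" "span Basis = UNIV"
  by (auto simp: orthonormal_def inner_Basis)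

lemma orthonormal_expansion:
  assumes B: "orthonormal B" and x: "x \<in> span B"
  shows "(\<Sum>b\<in>B. (x \<bullet> b) *\<^sub>R b) = x"
proof (rule orthonormal_basis_expand)
  show "pairwise orthogonal B"
    using B by (auto simp: orthonormal_def pairwise_def orthogonal_def)
  show "\<And>x. x \<in> B \<Longrightarrow> norm x = 1" using B by (simp add: orthonormal_def norm_eq_1)
  show "finite B" using B by (simp add: orthonormal_def)
qed (rule x)

lemma orthonormal_sum_squares:
  assumes B: "orthonormal B" and x: "x \<in> span B"
  shows "(\<Sum>b\<in>B. (x \<bullet> b)\<^sup>2) = x \<bullet> x"
proof -
  have "x \<bullet> x = (\<Sum>b\<in>B. (x \<bullet> b) *\<^sub>R b) \<bullet> x" using orthonormal_expansion[OF assms] by simp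
  also have "\<dots> = (\<Sum>b\<in>B. (x \<bullet> b)\<^sup>2)"
    unfolding inner_sum_left by (simp add: power2_eq_square inner_commute[of x])
  finally show ?thesis by simp
qed

lemma trace_basis_independent:
  fixes \<beta> :: "'a::euclidean_space \<Rightarrow> 'a \<Rightarrow> real"
  assumes \<beta>: "bilinear \<beta>" and B: "orthonormal B" and C: "orthonormal C" and BC: "span B = span C"
  shows "(\<Sum>b\<in>B. \<beta> b b) = (\<Sum>c\<in>C. \<beta> c c)"
proof -
  have lin: "linear (\<lambda>x. \<beta> x y)" "linear (\<beta> x)" for x y using \<beta> by (simp_all add: bilinear_def)
  have "(\<Sum>b\<in>B. \<beta> b b) = (\<Sum>b\<in>B. \<beta> (\<Sum>c\<in>C. (b \<bullet> c) *\<^sub>R c) b)"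
  proof (rule sum.cong[OF refl])
    fix b assume "b \<in> B"
    then have "b \<in> span C" using BC span_base by metis
    then show "\<beta> b b = \<beta> (\<Sum>c\<in>C. (b \<bullet> c) *\<^sub>R c) b" by (simp add: orthonormal_expansion[OF C])
  qed
  also have "\<dots> = (\<Sum>b\<in>B. \<Sum>c\<in>C. (b \<bullet> c) * \<beta> c b)"
    by (simp add: linear_sum[OF lin(1)] linear_cmul[OF lin(1)])
  also have "\<dots> = (\<Sum>c\<in>C. \<Sum>b\<in>B. (b \<bullet> c) * \<beta> c b)" by (rule sum.swap)
  also have "\<dots> = (\<Sum>c\<in>C. \<beta> c (\<Sum>b\<in>B. (c \<bullet> b) *\<^sub>R b))"
    by (simp add: linear_sum[OF lin(2)] linear_cmul[OF lin(2)] inner_commute)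
  also have "\<dots> = (\<Sum>c\<in>C. \<beta> c c)"
  proof (rule sum.cong[OF refl])
    fix c assume "c \<in> C"
    then have "c \<in> span B" using BC span_base by metis
    then show "\<beta> c (\<Sum>b\<in>B. (c \<bullet> b) *\<^sub>R b) = \<beta> c c" by (simp add: orthonormal_expansion[OF B])
  qed
  finally show ?thesis .
qed

text \<open>The trace of an endomorphism of a subspace is the same in an orthonormal basis as in an arbitrary
basis \<open>v\<close> with coordinate functions \<open>h\<close>. This moves traces between orthonormal bases adapted to a
metric and the vectors \<open>e i\<close>, which are unrelated to it.\<close>
lemma trace_on_subspace:
  assumes B: "orthonormal B" and D: "linear D" and inv: "\<And>x. x \<in> span B \<Longrightarrow> D x \<in> span B"
    and v: "\<And>i. i \<in> I \<Longrightarrow> v i \<in> span B" and h: "\<And>i. i \<in> I \<Longrightarrow> linear (h i)"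
    and exp: "\<And>x. x \<in> span B \<Longrightarrow> x = (\<Sum>i\<in>I. h i x *\<^sub>R v i)"
  shows "(\<Sum>b\<in>B. D b \<bullet> b) = (\<Sum>i\<in>I. h i (D (v i)) :: real)"
proof -
  have "(\<Sum>b\<in>B. D b \<bullet> b) = (\<Sum>b\<in>B. D (\<Sum>i\<in>I. h i b *\<^sub>R v i) \<bullet> b)"
    by (rule sum.cong[OF refl]) (subst exp[symmetric], auto simp: span_base)
  also have "\<dots> = (\<Sum>b\<in>B. \<Sum>i\<in>I. h i b * (D (v i) \<bullet> b))"
    by (simp add: linear_sum[OF D] linear_cmul[OF D] inner_sum_left)
  also have "\<dots> = (\<Sum>i\<in>I. \<Sum>b\<in>B. (D (v i) \<bullet> b) * h i b)" by (subst sum.swap) (simp add: mult.commute)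
  also have "\<dots> = (\<Sum>i\<in>I. h i (\<Sum>b\<in>B. (D (v i) \<bullet> b) *\<^sub>R b))"
    by (rule sum.cong[OF refl]) (simp add: linear_sum[OF h] linear_cmul[OF h])
  also have "\<dots> = (\<Sum>i\<in>I. h i (D (v i)))"
    by (rule sum.cong[OF refl]) (simp add: orthonormal_expansion[OF B] inv v)
  finally show ?thesis .
qed

lemma orthonormal_extend:
  assumes A: "orthonormal A" and T: "subspace T" and AT: "A \<subseteq> T"
  obtains B where "orthonormal (A \<union> B)" "A \<inter> B = {}" "span (A \<union> B) = T"
    "\<And>a b. a \<in> A \<Longrightarrow> b \<in> B \<Longrightarrow> a \<bullet> b = 0"
proof -
  define S where "S = T \<inter> {y. \<forall>a\<in>A. a \<bullet> y = 0}"
  have S: "subspace S"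
    using T unfolding S_def subspace_def by (auto simp: inner_right_distrib)
  obtain B where B: "B \<subseteq> S" "pairwise orthogonal B" "\<And>x. x \<in> B \<Longrightarrow> norm x = 1" "independent B" "span B = S"
    using orthonormal_basis_subspace[OF S] by metis
  have "finite B" using B(4) by (simp add: independent_imp_finite)
  have orth: "a \<bullet> b = 0" if "a \<in> A" "b \<in> B" for a b using that B(1) by (auto simp: S_def)
  have dis: "A \<inter> B = {}"
  proof (rule ccontr)
    assume "A \<inter> B \<noteq> {}"
    then obtain a where "a \<in> A" "a \<in> B" by blast
    then show False using orth[of a a] B(3)[of a] by auto
  qed
  have ON: "orthonormal (A \<union> B)"
    unfolding orthonormal_def
  proof (intro conjI ballI)
    show "finite (A \<union> B)" using A \<open>finite B\<close> by (simp add: orthonormal_def)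
    have AA: "a \<bullet> a' = (if a = a' then 1 else 0)" if "a \<in> A" "a' \<in> A" for a a'
      using A that by (simp add: orthonormal_def)
    have BB: "b \<bullet> b' = (if b = b' then 1 else 0)" if "b \<in> B" "b' \<in> B" for b b'
      using B(2,3) that by (simp add: pairwise_def orthogonal_def norm_eq_1)
    fix x y assume "x \<in> A \<union> B" "y \<in> A \<union> B"
    then show "x \<bullet> y = (if x = y then 1 else 0)"
      using AA BB orth dis inner_commute[of x y] by (elim UnE) (metis disjoint_iff)+
  qed
  have "span (A \<union> B) = T"
  proof
    show "span (A \<union> B) \<subseteq> T" using AT B(1) T by (intro span_minimal) (auto simp: S_def)
    show "T \<subseteq> span (A \<union> B)"
    proof
      fix y assume y: "y \<in> T"
      define p where "p = (\<Sum>a\<in>A. (y \<bullet> a) *\<^sub>R a)"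
      have p: "p \<in> span A" unfolding p_def by (intro span_sum span_scale span_base)
      then have "p \<in> T" using AT T span_minimal by blast
      have "a \<bullet> p = y \<bullet> a" if a: "a \<in> A" for a
      proof -
        have "a \<bullet> p = (\<Sum>a'\<in>A. if a = a' then y \<bullet> a' else 0)"
          unfolding p_def inner_sum_right using A a by (intro sum.cong refl) (simp add: orthonormal_def)
        also have "\<dots> = y \<bullet> a" using A a by (simp add: orthonormal_def)
        finally show ?thesis .
      qed
      then have "y - p \<in> S" using y \<open>p \<in> T\<close> T
        by (auto simp: S_def subspace_diff inner_diff_right inner_commute)
      then have "y - p \<in> span (A \<union> B)" using B(5) span_mono[of B "A \<union> B"] by blast
      moreover have "p \<in> span (A \<union> B)" using p span_mono[of A "A \<union> B"] by blast
      ultimately show "y \<in> span (A \<union> B)" using span_add by fastforce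
    qed
  qed
  with ON dis orth show ?thesis using that by blast
qed

lemma sum_Basis_adjoint:
  fixes \<beta> :: "'a::euclidean_space \<Rightarrow> 'a \<Rightarrow> real"
  assumes \<beta>: "bilinear \<beta>" and D: "linear D"
  shows "(\<Sum>b\<in>Basis. \<beta> (D b) b) = (\<Sum>b\<in>Basis. \<beta> b (adjoint D b))"
proof -
  have lin: "linear (\<lambda>x. \<beta> x y)" "linear (\<beta> x)" for x y using \<beta> by (simp_all add: bilinear_def)
  have "(\<Sum>b\<in>Basis. \<beta> (D b) b) = (\<Sum>b\<in>Basis. \<beta> (\<Sum>c\<in>Basis. (D b \<bullet> c) *\<^sub>R c) b)"
    by (simp add: euclidean_representation)
  also have "\<dots> = (\<Sum>b\<in>Basis. \<Sum>c\<in>Basis. (D b \<bullet> c) * \<beta> c b)"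
    by (simp add: linear_sum[OF lin(1)] linear_cmul[OF lin(1)])
  also have "\<dots> = (\<Sum>c\<in>Basis. \<Sum>b\<in>Basis. (D b \<bullet> c) * \<beta> c b)" by (rule sum.swap)
  also have "\<dots> = (\<Sum>c\<in>Basis. \<beta> c (\<Sum>b\<in>Basis. (adjoint D c \<bullet> b) *\<^sub>R b))"
    by (simp add: linear_sum[OF lin(2)] linear_cmul[OF lin(2)] adjoint_clauses[OF D] inner_commute)
  also have "\<dots> = (\<Sum>c\<in>Basis. \<beta> c (adjoint D c))" by (simp add: euclidean_representation)
  finally show ?thesis .
qed

lemma trace_commute:
  fixes F G :: "'a::euclidean_space \<Rightarrow> 'a"
  assumes F: "linear F" and G: "linear G"
  shows "(\<Sum>b\<in>Basis. F (G b) \<bullet> b) = (\<Sum>b\<in>Basis. G (F b) \<bullet> b)"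
proof -
  have "(\<Sum>b\<in>Basis. F (G b) \<bullet> b) = (\<Sum>b\<in>Basis. F b \<bullet> adjoint G b)"
    by (rule sum_Basis_adjoint[OF bilinear_inner[OF F linear_id[unfolded id_def]] G])
  also have "\<dots> = (\<Sum>b\<in>Basis. G (F b) \<bullet> b)" by (simp add: adjoint_clauses[OF G])
  finally show ?thesis .
qed

text \<open>In an orthonormal basis adapted to the kernel all diagonal entries vanish: \<open>A\<close> kills the kernel and
maps its orthogonal complement into it.\<close>
lemma trace_eq_0_of_square_zero:
  fixes A :: "'a::euclidean_space \<Rightarrow> 'a"
  assumes A: "linear A" and A2: "\<And>x. A (A x) = 0"
  shows "(\<Sum>b\<in>Basis. A b \<bullet> b) = 0"
proof -
  define K where "K = {x. A x = 0}"
  have K: "subspace K" unfolding K_def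
    by (simp add: subspace_def linear_0[OF A] linear_add[OF A] linear_cmul[OF A])
  obtain B where B: "orthonormal B" "span B = K"
    using orthonormal_extend[of "{}" K] K by (auto simp: orthonormal_def)
  obtain C where C: "orthonormal (B \<union> C)" "B \<inter> C = {}" "span (B \<union> C) = UNIV"
      and perp: "\<And>b c. b \<in> B \<Longrightarrow> c \<in> C \<Longrightarrow> b \<bullet> c = 0"
    using orthonormal_extend[OF B(1), of UNIV] by auto
  have "(\<Sum>b\<in>Basis. A b \<bullet> b) = (\<Sum>b\<in>B \<union> C. A b \<bullet> b)"
    by (rule trace_basis_independent[OF bilinear_inner[OF A linear_id[unfolded id_def]] orthonormal_Basis(1) C(1)])
      (simp add: C(3))
  also have "\<dots> = 0"
  proof (rule sum.neutral, rule ballI)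
    fix b assume "b \<in> B \<union> C"
    then show "A b \<bullet> b = 0"
    proof
      assume "b \<in> B"
      then have "b \<in> K" using B(2) span_base by metis
      then show ?thesis by (simp add: K_def)
    next
      assume b: "b \<in> C"
      have "A b \<in> span B" unfolding B(2) K_def by (simp add: A2)
      then show ?thesis
        using orthogonal_to_span[of "A b" B b] perp[OF _ b] by (auto simp: orthogonal_def inner_commute)
    qed
  qed
  finally show ?thesis .
qed

lemma sum_Basis_vec:
  fixes f :: "real^'n \<Rightarrow> real"
  shows "(\<Sum>b\<in>Basis. f b) = (\<Sum>i\<in>UNIV. f (axis i 1))"
proof (rule sum.reindex_cong[of "\<lambda>i. axis i 1"])
  show "inj (\<lambda>i::'n. axis i 1 :: real^'n)" by (auto simp: inj_on_def axis_eq_axis)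
  show "Basis = range (\<lambda>i. axis i 1 :: real^'n)" unfolding Basis_vec_def by auto
qed simp

section \<open>The Ricci form of a bracket\<close>

text \<open>The quadratic form of the Ricci operator of a nilpotent metric Lie algebra. For a bracket that is
not nilpotent it is only one of the terms of the Ricci tensor.\<close>
definition nil_ricci :: "('a::euclidean_space \<Rightarrow> 'a \<Rightarrow> 'a) \<Rightarrow> 'a \<Rightarrow> real" where
  "nil_ricci \<nu> x = - 1/2 * (\<Sum>b\<in>Basis. \<nu> x b \<bullet> \<nu> x b) + 1/4 * (\<Sum>b\<in>Basis. \<Sum>c\<in>Basis. (\<nu> b c \<bullet> x)\<^sup>2)"

lemma nil_ricci_orthonormal:
  assumes \<nu>: "bilinear \<nu>" and B: "orthonormal B" "span B = UNIV"
  shows "nil_ricci \<nu> x = - 1/2 * (\<Sum>b\<in>B. \<Sum>c\<in>B. (\<nu> x b \<bullet> c)\<^sup>2) + 1/4 * (\<Sum>b\<in>B. \<Sum>c\<in>B. (\<nu> b c \<bullet> x)\<^sup>2)"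
proof -
  have lin: "linear (\<lambda>x. \<nu> x y)" "linear (\<nu> x)" for x y using \<nu> by (simp_all add: bilinear_def)
  note ti = trace_basis_independent[OF _ orthonormal_Basis(1) B(1)]
  have sp: "span Basis = span B" using B(2) orthonormal_Basis(2) by simp
  have "(\<Sum>b\<in>Basis. \<nu> x b \<bullet> \<nu> x b) = (\<Sum>b\<in>B. \<nu> x b \<bullet> \<nu> x b)"
    by (rule ti[OF _ sp]) (intro bilinear_inner lin)
  also have "\<dots> = (\<Sum>b\<in>B. \<Sum>c\<in>B. (\<nu> x b \<bullet> c)\<^sup>2)"
    by (simp add: orthonormal_sum_squares[OF B(1)] B(2))
  finally have 1: "(\<Sum>b\<in>Basis. \<nu> x b \<bullet> \<nu> x b) = (\<Sum>b\<in>B. \<Sum>c\<in>B. (\<nu> x b \<bullet> c)\<^sup>2)" .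
  have lx: "linear (\<lambda>y. \<nu> y c \<bullet> x)" "linear (\<lambda>y. \<nu> c y \<bullet> x)" for c
    using lin unfolding linear_iff by (simp_all add: inner_left_distrib)
  have bil: "bilinear (\<lambda>y z. f y * g z)" if "linear f" "linear g" for f g :: "'a \<Rightarrow> real"
    using that unfolding bilinear_def linear_iff by (simp add: algebra_simps)
  have "(\<Sum>b\<in>Basis. \<Sum>c\<in>Basis. (\<nu> b c \<bullet> x)\<^sup>2) = (\<Sum>b\<in>Basis. \<Sum>c\<in>B. (\<nu> b c \<bullet> x)\<^sup>2)"
    unfolding power2_eq_square by (intro sum.cong refl ti[OF _ sp] bil lx)
  also have "\<dots> = (\<Sum>c\<in>B. \<Sum>b\<in>Basis. (\<nu> b c \<bullet> x)\<^sup>2)" by (rule sum.swap)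
  also have "\<dots> = (\<Sum>c\<in>B. \<Sum>b\<in>B. (\<nu> b c \<bullet> x)\<^sup>2)"
    unfolding power2_eq_square by (intro sum.cong refl ti[OF _ sp] bil lx)
  also have "\<dots> = (\<Sum>b\<in>B. \<Sum>c\<in>B. (\<nu> b c \<bullet> x)\<^sup>2)" by (rule sum.swap)
  finally show ?thesis unfolding nil_ricci_def 1 by simp
qed

text \<open>Pairing the Ricci form with the symmetric operator \<open>E\<close> that has eigenvalues \<open>\<epsilon>\<close> on the basis \<open>B\<close>
gives a quarter of \<open>\<langle>\<pi>(E) \<nu>, \<nu>\<rangle>\<close>, where \<open>\<pi>(E) \<nu> = E \<circ> \<nu> - \<nu>(E _, _) - \<nu>(_, E _)\<close>: up to a constant
factor the Ricci operator is the moment map for the linear group acting on brackets. The structure constants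
are eigenvectors of \<open>\<pi>(E)\<close> with the eigenvalues \<open>\<epsilon> c - \<epsilon> a - \<epsilon> b\<close>.\<close>
lemma weighted_nil_ricci:
  fixes \<epsilon> :: "'a::euclidean_space \<Rightarrow> real"
  assumes \<nu>: "bilinear \<nu>" and skew: "\<And>x y. \<nu> x y = - \<nu> y x" and B: "orthonormal B" "span B = UNIV"
  shows "(\<Sum>b\<in>B. \<epsilon> b * nil_ricci \<nu> b)
    = 1/4 * (\<Sum>a\<in>B. \<Sum>b\<in>B. \<Sum>c\<in>B. (\<epsilon> c - \<epsilon> a - \<epsilon> b) * (\<nu> a b \<bullet> c)\<^sup>2)"
proof -
  let ?q = "\<lambda>a b c. (\<nu> a b \<bullet> c)\<^sup>2"
  have sk: "?q a b c = ?q b a c" for a b c by (subst skew) simp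
  have 1: "(\<Sum>a\<in>B. \<Sum>b\<in>B. \<Sum>c\<in>B. \<epsilon> b * ?q a b c) = (\<Sum>a\<in>B. \<Sum>b\<in>B. \<Sum>c\<in>B. \<epsilon> a * ?q a b c)"
    by (subst sum.swap) (simp add: sk)
  have 2: "(\<Sum>a\<in>B. \<Sum>b\<in>B. \<Sum>c\<in>B. \<epsilon> c * ?q a b c) = (\<Sum>c\<in>B. \<Sum>a\<in>B. \<Sum>b\<in>B. \<epsilon> c * ?q a b c)"
    by (subst sum.swap[of _ B B], subst sum.swap[of _ B B, symmetric]) (simp add: sum.swap[of "\<lambda>b c. \<epsilon> c * ?q _ b c"])
  have "(\<Sum>b\<in>B. \<epsilon> b * nil_ricci \<nu> b)
    = - 1/2 * (\<Sum>a\<in>B. \<Sum>b\<in>B. \<Sum>c\<in>B. \<epsilon> a * ?q a b c) + 1/4 * (\<Sum>c\<in>B. \<Sum>a\<in>B. \<Sum>b\<in>B. \<epsilon> c * ?q a b c)"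
    unfolding nil_ricci_orthonormal[OF \<nu> B]
    by (simp add: distrib_left sum.distrib sum_distrib_left mult.left_commute)
  also have "\<dots> = 1/4 * ((\<Sum>a\<in>B. \<Sum>b\<in>B. \<Sum>c\<in>B. \<epsilon> c * ?q a b c)
      - (\<Sum>a\<in>B. \<Sum>b\<in>B. \<Sum>c\<in>B. \<epsilon> a * ?q a b c) - (\<Sum>a\<in>B. \<Sum>b\<in>B. \<Sum>c\<in>B. \<epsilon> b * ?q a b c))"
    unfolding 1 2 by simp
  also have "\<dots> = 1/4 * (\<Sum>a\<in>B. \<Sum>b\<in>B. \<Sum>c\<in>B. (\<epsilon> c - \<epsilon> a - \<epsilon> b) * ?q a b c)"
    by (simp only: left_diff_distrib sum_subtractf)
  finally show ?thesis .
qed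

section \<open>Absence of nilsoliton metrics\<close>

text \<open>The bracket is destabilised by a one-parameter group: give \<open>e 1, \<dots>, e 4\<close> the weight -1,
\<open>e 5, e 6\<close> the weight 2, \<open>e 7, e 8\<close> the weight 1 and \<open>e 9\<close> the weight -2. All brackets have
degree 0 except \<open>[e 1, e 2] = e 7\<close> and \<open>[e 3, e 4] = e 8\<close>, which have degree 3. For an arbitrary
metric the group is replaced by the symmetric operator \<open>E\<close> with the same weights and the same flag;
only the filtration by degree survives, so the structure constants have nonnegative degree, and
the trace of the Ricci form against \<open>E\<close> is nonnegative. On the other hand \<open>E\<close> has trace 0
and trace 0 against every derivation, because derivations preserve the flag and have a known diagonal.
So the trace is 0 and all structure constants of positive degree vanish in the adapted orthonormal
basis. This contradicts that \<open>[e 1, e 2]\<close> has a nonzero component along \<open>e 7\<close>, which does not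
change when elements of \<open>\<langle>e 5, \<dots>, e 9\<rangle>\<close> are added to \<open>e 1\<close> and \<open>e 2\<close>.

The soliton equation is stated for quadratic forms since \<open>D\<close> may fail to be symmetric when
it comes from an Einstein solvmanifold.\<close>
lemma no_quadratic_nilsoliton:
  fixes \<nu> :: "'a::euclidean_space \<Rightarrow> 'a \<Rightarrow> 'a" and g :: "'a \<Rightarrow> real^9"
  assumes t: "t > 0" and g: "linear g" "bij g" and hom: "\<And>x y. g (\<nu> x y) = mu_bar t (g x) (g y)"
    and D: "linear D" and der: "\<And>x y. D (\<nu> x y) = \<nu> (D x) y + \<nu> x (D y)"
    and soliton: "\<And>x. nil_ricci \<nu> x = c * (x \<bullet> x) + D x \<bullet> x"
  shows False
proof -
  define h where "h = inv g"
  have gh: "g (h x) = x" and hg: "h (g y) = y" for x y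
    using g(2) by (simp_all add: h_def bij_is_surj surj_f_inv_f bij_is_inj)
  have ginj: "x = y" if "g x = g y" for x y using that hg by metis
  have h: "linear h"
    by (rule linearI; rule ginj) (simp_all add: gh linear_add[OF g(1)] linear_cmul[OF g(1)])
  have hhom: "\<nu> x y = h (mu_bar t (g x) (g y))" for x y by (rule ginj) (simp add: gh hom)
  have \<nu>: "bilinear \<nu>"
    using bilinear_mu_bar[of t] g(1) h unfolding bilinear_def linear_iff hhom by simp
  have skew: "\<nu> x y = - \<nu> y x" for x y
    unfolding hhom by (subst mu_bar_skew) (simp add: linear_neg[OF h])
  define D' where "D' x = g (D (h x))" for x
  have D': "linear D'" unfolding D'_def using g(1) h D unfolding linear_iff by simp
  have der': "D' (mu_bar t x y) = mu_bar t (D' x) y + mu_bar t x (D' y)" for x y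
  proof -
    have "h (mu_bar t x y) = \<nu> (h x) (h y)" by (simp add: hhom gh)
    then show ?thesis unfolding D'_def by (simp add: der linear_add[OF g(1)] hom gh)
  qed
  note ent = derivation_entries[OF t D' der']
  have gD: "g (D x) = D' (g x)" for x unfolding D'_def hg ..
  define U :: "9 set \<Rightarrow> 'a set" where "U I = {x. \<forall>i. i \<notin> I \<longrightarrow> g x $ i = 0}" for I
  have U: "subspace (U I)" for I
    unfolding subspace_def U_def by (simp add: linear_0[OF g(1)] linear_add[OF g(1)] linear_cmul[OF g(1)])
  have hU: "h (e i) \<in> U I" if "i \<in> I" for i I
    using that unfolding U_def by (auto simp: gh nth_e)
  have coord: "linear (\<lambda>x. g x $ i)" for i
    using g(1) unfolding linear_iff by simp
  have expand: "x = (\<Sum>i\<in>I. g x $ i *\<^sub>R h (e i))" if x: "x \<in> U I" for x I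
  proof (rule ginj)
    have "g x = (\<Sum>i\<in>UNIV. g x $ i *\<^sub>R e i)" by (simp add: basis_expansion flip: scalar_mult_eq_scaleR)
    also have "\<dots> = (\<Sum>i\<in>I. g x $ i *\<^sub>R e i)"
      using x by (intro sum.mono_neutral_right) (auto simp: U_def)
    also have "\<dots> = g (\<Sum>i\<in>I. g x $ i *\<^sub>R h (e i))"
      by (simp add: linear_sum[OF g(1)] linear_cmul[OF g(1)] gh)
    finally show "g x = \<dots>" .
  qed
  have trace: "(\<Sum>b\<in>B. F b \<bullet> b) = (\<Sum>i\<in>I. g (F (h (e i))) $ i)"
    if B: "orthonormal B" "span B = U I" and F: "linear F" and inv: "\<And>i. i \<in> I \<Longrightarrow> F (h (e i)) \<in> U I" for B F I
  proof (rule trace_on_subspace[OF B(1) F, where h = "\<lambda>i x. g x $ i"])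
    show "F x \<in> span B" if "x \<in> span B" for x
    proof -
      have x: "x = (\<Sum>i\<in>I. g x $ i *\<^sub>R h (e i))" using expand that B(2) by simp
      have "F x = (\<Sum>i\<in>I. g x $ i *\<^sub>R F (h (e i)))"
        by (subst x) (simp only: linear_sum[OF F] linear_cmul[OF F])
      then show ?thesis unfolding B(2) using inv U by (auto intro!: subspace_sum subspace_scale)
    qed
    show "linear (\<lambda>x. g x $ i)" for i by (rule coord)
  qed (use B(2) hU expand in auto)
  \<comment> \<open>The flag preserved by derivations, and an orthonormal basis adapted to it.\<close>
  let ?P = "{7,8::9}" and ?Z = "{7,8,9::9}" and ?M = "{5,6,7,8,9::9}"
  obtain B1 where B1: "orthonormal B1" "span B1 = U ?P"
    using orthonormal_extend[of "{}" "U ?P"] U[of ?P] by (auto simp: orthonormal_def)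
  have s1: "B1 \<subseteq> U ?Z" using span_superset[of B1] unfolding B1 U_def by auto
  obtain B2 where B2: "orthonormal (B1 \<union> B2)" "B1 \<inter> B2 = {}" "span (B1 \<union> B2) = U ?Z"
    using orthonormal_extend[OF B1(1) U s1] by metis
  have s2: "B1 \<union> B2 \<subseteq> U ?M" using span_superset[of "B1 \<union> B2"] unfolding B2 U_def by auto
  obtain B3 where B3: "orthonormal (B1 \<union> B2 \<union> B3)" "(B1 \<union> B2) \<inter> B3 = {}" "span (B1 \<union> B2 \<union> B3) = U ?M"
    using orthonormal_extend[OF B2(1) U s2] by metis
  have s3: "B1 \<union> B2 \<union> B3 \<subseteq> U UNIV" unfolding U_def by auto
  obtain B4 where B4: "orthonormal (B1 \<union> B2 \<union> B3 \<union> B4)" "(B1 \<union> B2 \<union> B3) \<inter> B4 = {}"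
      "span (B1 \<union> B2 \<union> B3 \<union> B4) = U UNIV"
    using orthonormal_extend[OF B3(1) U s3] by metis
  define B where "B = B1 \<union> B2 \<union> B3 \<union> B4"
  have UU: "U UNIV = UNIV" unfolding U_def by simp
  have ONB: "orthonormal B" "span B = UNIV" unfolding B_def using B4 UU by simp_all
  have fin: "finite B1" "finite B2" "finite B3" "finite B4" using B4(1) by (simp_all add: orthonormal_def)
  define \<epsilon> :: "'a \<Rightarrow> real" where
    "\<epsilon> b = (if b \<in> B1 then 1 else if b \<in> B2 then -2 else if b \<in> B3 then 2 else -1)" for b
  have sum_\<epsilon>: "(\<Sum>b\<in>B. \<epsilon> b * f b) = - (\<Sum>b\<in>B. f b) + 3 * (\<Sum>b\<in>B1 \<union> B2 \<union> B3. f b)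
     - 4 * (\<Sum>b\<in>B1 \<union> B2. f b) + 3 * (\<Sum>b\<in>B1. f b)" for f :: "'a \<Rightarrow> real"
  proof -
    have split: "sum k B = sum k B1 + sum k B2 + sum k B3 + sum k B4" for k :: "'a \<Rightarrow> real"
      unfolding B_def using fin B2(2) B3(2) B4(2) by (simp add: sum.union_disjoint)
    have "(\<Sum>b\<in>B1. \<epsilon> b * f b) = (\<Sum>b\<in>B1. f b)" by (rule sum.cong) (auto simp: \<epsilon>_def)
    moreover have "(\<Sum>b\<in>B2. \<epsilon> b * f b) = -2 * (\<Sum>b\<in>B2. f b)"
      unfolding sum_distrib_left by (rule sum.cong) (use B2(2) in \<open>auto simp: \<epsilon>_def\<close>)
    moreover have "(\<Sum>b\<in>B3. \<epsilon> b * f b) = 2 * (\<Sum>b\<in>B3. f b)"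
      unfolding sum_distrib_left by (rule sum.cong) (use B3(2) in \<open>auto simp: \<epsilon>_def\<close>)
    moreover have "(\<Sum>b\<in>B4. \<epsilon> b * f b) = - (\<Sum>b\<in>B4. f b)"
      unfolding sum_negf[symmetric] by (rule sum.cong) (use B4(2) in \<open>auto simp: \<epsilon>_def\<close>)
    ultimately show ?thesis
      unfolding split using fin B2(2) B3(2) by (simp add: sum.union_disjoint)
  qed
  have trs: "(\<Sum>b\<in>B1. F b \<bullet> b) = (\<Sum>i\<in>?P. g (F (h (e i))) $ i)"
      "(\<Sum>b\<in>B1 \<union> B2. F b \<bullet> b) = (\<Sum>i\<in>?Z. g (F (h (e i))) $ i)"
      "(\<Sum>b\<in>B1 \<union> B2 \<union> B3. F b \<bullet> b) = (\<Sum>i\<in>?M. g (F (h (e i))) $ i)"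
      "(\<Sum>b\<in>B. F b \<bullet> b) = (\<Sum>i\<in>UNIV. g (F (h (e i))) $ i)"
    if F: "linear F" and "\<And>i. i \<in> ?P \<Longrightarrow> F (h (e i)) \<in> U ?P" "\<And>i. i \<in> ?Z \<Longrightarrow> F (h (e i)) \<in> U ?Z"
      "\<And>i. i \<in> ?M \<Longrightarrow> F (h (e i)) \<in> U ?M" for F
    using trace[OF B1 F that(2)] trace[OF B2(1,3) F that(3)] trace[OF B3(1,3) F that(4)]
      trace[OF B4(1,3) F] UU unfolding B_def by simp_all
  have id: "(\<Sum>b\<in>B. \<epsilon> b * (b \<bullet> b)) = 0"
    unfolding sum_\<epsilon>
    using trs[OF linear_id[unfolded id_def] hU hU hU] by (simp add: gh sum_9)
  have Dtr: "(\<Sum>b\<in>B. \<epsilon> b * (D b \<bullet> b)) = 0"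
  proof -
    have DU: "D (h (e j)) \<in> U I \<longleftrightarrow> (\<forall>i. i \<notin> I \<longrightarrow> D' (e j) $ i = 0)" for j I
      unfolding U_def by (simp add: gD gh)
    have 1: "D (h (e i)) \<in> U ?P" if "i \<in> ?P" for i
      unfolding DU forall_9 using that ent(9,10) ent(11) by auto
    have 2: "D (h (e i)) \<in> U ?Z" if "i \<in> ?Z" for i
      unfolding DU forall_9 using that ent(11) by auto
    have 3: "D (h (e i)) \<in> U ?M" if "i \<in> ?M" for i
      unfolding DU forall_9 using that ent(8,11) by auto
    show ?thesis
      unfolding sum_\<epsilon> using trs[OF D 1 2 3] by (simp add: gD gh sum_9 ent(1-7))
  qed
  have "(\<Sum>b\<in>B. \<epsilon> b * nil_ricci \<nu> b) = c * (\<Sum>b\<in>B. \<epsilon> b * (b \<bullet> b)) + (\<Sum>b\<in>B. \<epsilon> b * (D b \<bullet> b))"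
    unfolding soliton by (simp add: distrib_left sum.distrib sum_distrib_left mult.left_commute)
  then have zero: "(\<Sum>a\<in>B. \<Sum>b\<in>B. \<Sum>c\<in>B. (\<epsilon> c - \<epsilon> a - \<epsilon> b) * (\<nu> a b \<bullet> c)\<^sup>2) = 0"
    unfolding weighted_nil_ricci[OF \<nu> skew ONB] id Dtr by simp
  have orth: "x \<bullet> y = 0" if "x \<in> span X" "y \<in> Y" "X \<union> Y \<subseteq> B" "X \<inter> Y = {}" for x y X Y
  proof -
    have "b \<bullet> y = 0" if "b \<in> X" for b
      using that \<open>y \<in> Y\<close> \<open>X \<union> Y \<subseteq> B\<close> \<open>X \<inter> Y = {}\<close> ONB(1) unfolding orthonormal_def
      by (metis Un_iff disjoint_iff subsetD)
    then show ?thesis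
      using orthogonal_to_span[OF \<open>x \<in> span X\<close>, of y] by (simp add: orthogonal_def inner_commute)
  qed
  have mem: "x \<in> U I" if "x \<in> X" "span X = U I" for x X I using that span_base by blast
  have gU: "g x $ i = 0" if "x \<in> U I" "i \<notin> I" for x i I using that by (simp add: U_def)
  have \<nu>Z: "\<nu> x y \<in> U ?Z" for x y
    unfolding U_def mem_Collect_eq forall_9 hom by simp
  have \<nu>P: "\<nu> x y \<in> U ?P" if "x \<in> U ?M" for x y
    unfolding U_def mem_Collect_eq forall_9 hom using gU[OF that] by (simp add: wedge_def)
  have central: "\<nu> x y = 0" "\<nu> y x = 0" if "x \<in> U ?Z" for x y
  proof -
    show "\<nu> x y = 0" for y
      unfolding hhom using gU[OF that] by (simp add: mu_bar_central linear_0[OF h])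
    from this[of y] show "\<nu> y x = 0" using skew[of y x] by simp
  qed
  have abelian: "\<nu> x y = 0" if "x \<in> U ?M" "y \<in> U ?M" for x y
    by (rule ginj) (use gU[OF that(1)] gU[OF that(2)] in \<open>simp add: hom linear_0[OF g(1)] vec9_eq_iff wedge_def\<close>)
  have weights: "0 \<le> (\<epsilon> c - \<epsilon> a - \<epsilon> b) * (\<nu> a b \<bullet> c)\<^sup>2" if abc: "a \<in> B" "b \<in> B" "c \<in> B" for a b c
  proof (cases "\<nu> a b \<bullet> c = 0")
    case False
    have c: "c \<in> B1 \<union> B2"
    proof (rule ccontr)
      assume "c \<notin> B1 \<union> B2"
      then have "\<nu> a b \<bullet> c = 0"
        using orth[of "\<nu> a b" "B1 \<union> B2" c "{c}"] \<nu>Z[of a b] abc(3) unfolding B2(3) by (auto simp: B_def)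
      then show False using False by simp
    qed
    have a: "a \<in> B3 \<union> B4" and b: "b \<in> B3 \<union> B4"
      using False abc central mem[OF _ B2(3)] unfolding B_def by (metis Un_iff inner_zero_left)+
    have \<epsilon>3: "\<epsilon> x = 2" if "x \<in> B3" for x using that B3(2) by (auto simp: \<epsilon>_def)
    have \<epsilon>4: "\<epsilon> x = -1" if "x \<in> B4" for x using that B4(2) by (auto simp: \<epsilon>_def)
    have M3: "x \<in> U ?M" if "x \<in> B3" for x using mem[OF _ B3(3)] that by blast
    show ?thesis
    proof (cases "a \<in> B4 \<and> b \<in> B4")
      case True
      then show ?thesis using \<epsilon>4 c by (auto simp: \<epsilon>_def)
    next
      case ab: False
      have "\<not> (a \<in> B3 \<and> b \<in> B3)" using abelian M3 False by auto
      then have sum: "\<epsilon> a + \<epsilon> b = 1" using a b ab \<epsilon>3 \<epsilon>4 by auto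
      have "\<nu> a b \<in> U ?P"
        using a b ab \<nu>P M3 skew[of a b] subspace_neg[OF U] by (metis Un_iff)
      then have "c \<in> B1"
        using orth[of "\<nu> a b" B1 c B2] c B2(2) False unfolding B1(2) B_def by auto
      then have "\<epsilon> c = 1" by (simp add: \<epsilon>_def)
      with sum show ?thesis by (simp add: algebra_simps)
    qed
  qed simp
  have vanish: "\<nu> a b \<bullet> c = 0" if "a \<in> B4" "b \<in> B4" "c \<in> B1" for a b c
  proof -
    have finB: "finite B" using ONB(1) by (simp add: orthonormal_def)
    have abc: "a \<in> B" "b \<in> B" "c \<in> B" using that by (auto simp: B_def)
    have "(\<Sum>b\<in>B. \<Sum>c\<in>B. (\<epsilon> c - \<epsilon> a - \<epsilon> b) * (\<nu> a b \<bullet> c)\<^sup>2) = 0"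
      using zero finB abc by (subst (asm) sum_nonneg_eq_0_iff) (auto intro!: sum_nonneg weights)
    then have "(\<Sum>c\<in>B. (\<epsilon> c - \<epsilon> a - \<epsilon> b) * (\<nu> a b \<bullet> c)\<^sup>2) = 0"
      using finB abc by (subst (asm) sum_nonneg_eq_0_iff) (auto intro!: sum_nonneg weights)
    then have "(\<epsilon> c - \<epsilon> a - \<epsilon> b) * (\<nu> a b \<bullet> c)\<^sup>2 = 0"
      using finB abc by (subst (asm) sum_nonneg_eq_0_iff) (auto intro!: weights)
    moreover have "\<epsilon> c - \<epsilon> a - \<epsilon> b = 3" using that B4(2) by (auto simp: \<epsilon>_def)
    ultimately show ?thesis by simp
  qed
  \<comment> \<open>The span of \<open>B4\<close> is a complement of \<open>U ?M\<close>; it contains lifts of \<open>e 1\<close> and \<open>e 2\<close>.\<close>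
  have lift: "\<exists>y\<in>span B4. x - y \<in> U ?M" for x
  proof -
    define y where "y = (\<Sum>b\<in>B4. (x \<bullet> b) *\<^sub>R b)"
    have "x = (\<Sum>b\<in>B. (x \<bullet> b) *\<^sub>R b)" using orthonormal_expansion[OF ONB(1)] ONB(2) by simp
    also have "\<dots> = (\<Sum>b\<in>B1 \<union> B2 \<union> B3. (x \<bullet> b) *\<^sub>R b) + y"
      unfolding B_def y_def using fin B4(2) by (intro sum.union_disjoint) auto
    finally have "x - y = (\<Sum>b\<in>B1 \<union> B2 \<union> B3. (x \<bullet> b) *\<^sub>R b)" by (metis add_diff_cancel_right')
    then have "x - y \<in> U ?M"
      unfolding B3(3)[symmetric] by (simp only:) (intro span_sum span_scale span_base)
    moreover have "y \<in> span B4" unfolding y_def by (intro span_sum span_scale span_base)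
    ultimately show ?thesis by blast
  qed
  obtain x y where x: "x \<in> span B4" "h (e 1) - x \<in> U ?M" and y: "y \<in> span B4" "h (e 2) - y \<in> U ?M"
    using lift by metis
  have gx: "g x $ 1 = 1" "g x $ 2 = 0" "g x $ 3 = 0" "g x $ 4 = 0"
    and gy: "g y $ 1 = 0" "g y $ 2 = 1" "g y $ 3 = 0" "g y $ 4 = 0"
  proof -
    have *: "g w $ i = e j $ i" if "h (e j) - w \<in> U ?M" "i \<in> {1,2,3,4}" for w i j
      using gU[OF that(1), of i] that(2) by (auto simp: linear_diff[OF g(1)] gh)
    show "g x $ 1 = 1" "g x $ 2 = 0" "g x $ 3 = 0" "g x $ 4 = 0" using *[OF x(2)] by (simp_all add: nth_e)
    show "g y $ 1 = 0" "g y $ 2 = 1" "g y $ 3 = 0" "g y $ 4 = 0" using *[OF y(2)] by (simp_all add: nth_e)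
  qed
  have "\<nu> x y \<in> U ?P"
    unfolding U_def mem_Collect_eq forall_9 hom using gx gy by (simp add: wedge_def)
  moreover have "\<nu> x y \<bullet> c = 0" if c: "c \<in> B1" for c
  proof -
    have l: "linear (\<lambda>x. \<nu> x y \<bullet> c)" "linear (\<lambda>y. \<nu> x y \<bullet> c)" for x y
      using \<nu> unfolding bilinear_def linear_iff by (simp_all add: inner_left_distrib)
    have "\<nu> a y \<bullet> c = 0" if "a \<in> B4" for a
      using linear_eq_on_span[OF l(2) linear_zero _ y(1)] vanish[OF that _ c] by simp
    then show ?thesis using linear_eq_on_span[OF l(1) linear_zero _ x(1)] by simp
  qed
  ultimately have "\<nu> x y = 0"
    using orthonormal_expansion[OF B1(1), of "\<nu> x y"] B1(2) by simp
  then have "mu_bar t (g x) (g y) $ 7 = 0" using hom[of x y] linear_0[OF g(1)] by simp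
  then show False using gx gy by (simp add: wedge_def)
qed

text \<open>The orthonormal basis \<open>x\<close> of the given inner product defines an isometry \<open>g\<close> from the standard
Euclidean space; the bracket is pulled back along it.\<close>
lemma no_nilsoliton:
  assumes t: "t > 0"
  shows "\<not> admits_nilsoliton (mu_bar t)"
proof
  assume "admits_nilsoliton (mu_bar t)"
  then obtain ip c D where ip: "inner_product ip" and D: "lie_derivation (mu_bar t) D"
    and op: "is_nil_ricci_operator (mu_bar t) ip (\<lambda>X. c *\<^sub>R X + D X)"
    unfolding admits_nilsoliton_def by auto
  from op obtain x :: "9 \<Rightarrow> real^9" where "\<forall>i j. ip (x i) (x j) = (if i = j then 1 else 0)"
    and "\<forall>X Y. ip (c *\<^sub>R X + D X) Y =
          - 1/2 * (\<Sum>i\<in>UNIV. \<Sum>j\<in>UNIV. ip (mu_bar t X (x i)) (x j) * ip (mu_bar t Y (x i)) (x j))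
          + 1/4 * (\<Sum>i\<in>UNIV. \<Sum>j\<in>UNIV. ip (mu_bar t (x i) (x j)) X * ip (mu_bar t (x i) (x j)) Y)"
    unfolding is_nil_ricci_operator_def by (elim exE conjE) (rule that, assumption+)
  note x = this(1)[rule_format] and ric = this(2)[rule_format]
  have bil: "bilinear ip" using ip by (simp add: inner_product_def)
  have lin: "linear (\<lambda>x. ip x y)" "linear (ip x)" for x y using bil by (simp_all add: bilinear_def)
  have Dlin: "linear D" and Dder: "\<And>x y. D (mu_bar t x y) = mu_bar t (D x) y + mu_bar t x (D y)"
    using D by (simp_all add: lie_derivation_def)
  define g :: "real^9 \<Rightarrow> real^9" where "g v = (\<Sum>i\<in>UNIV. v $ i *\<^sub>R x i)" for v
  have g: "linear g" unfolding g_def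
    by (rule linearI) (simp_all add: scaleR_add_left sum.distrib scaleR_sum_right)
  have isom: "ip (g v) (g w) = v \<bullet> w" for v w
  proof -
    have "ip (g v) (g w) = (\<Sum>j\<in>UNIV. \<Sum>i\<in>UNIV. w $ j * (v $ i * ip (x i) (x j)))"
      unfolding g_def by (simp only: linear_sum[OF lin(1)] linear_sum[OF lin(2)] linear_cmul[OF lin(1)] linear_cmul[OF lin(2)] sum_distrib_left real_scaleR_def)
    also have "\<dots> = (\<Sum>j\<in>UNIV. w $ j * v $ j)" by (simp add: x if_distrib sum.delta cong: if_cong)
    finally show ?thesis by (simp add: inner_vec_def mult.commute)
  qed
  have inj: "inj g"
  proof (rule linear_injective_0[OF g, THEN iffD2], intro allI impI)
    fix v assume "g v = 0"
    then have "v \<bullet> v = 0" using isom[of v v] linear_0[OF lin(1)] by simp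
    then show "v = 0" by simp
  qed
  have bij: "bij g" using inj linear_injective_imp_surjective[OF g inj] by (simp add: bij_def)
  define h where "h = inv g"
  have h: "linear h" unfolding h_def by (rule inj_linear_imp_inv_linear[OF g inj])
  have gh: "g (h y) = y" and hg: "h (g y) = y" for y
    using bij by (simp_all add: h_def bij_is_surj surj_f_inv_f inj)
  have ge: "g (e i) = x i" for i
    unfolding g_def by (simp add: axis_def if_distrib[of "\<lambda>c. c *\<^sub>R _"] sum.delta cong: if_cong)
  define \<nu> where "\<nu> v w = h (mu_bar t (g v) (g w))" for v w
  have \<nu>ip: "\<nu> v w \<bullet> u = ip (mu_bar t (g v) (g w)) (g u)" for u v w
    unfolding \<nu>_def isom[symmetric] gh ..
  show False
  proof (rule no_quadratic_nilsoliton[OF t g bij, of \<nu> "\<lambda>v. h (D (g v))" c])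
    show "g (\<nu> v w) = mu_bar t (g v) (g w)" for v w by (simp add: \<nu>_def gh)
    show "linear (\<lambda>v. h (D (g v)))" using g h Dlin unfolding linear_iff by simp
    show "h (D (g (\<nu> v w))) = \<nu> (h (D (g v))) w + \<nu> v (h (D (g w)))" for v w
      unfolding \<nu>_def gh by (simp add: Dder linear_add[OF h])
    fix v
    have on: "orthonormal (Basis :: (real^9) set)" "span (Basis :: (real^9) set) = UNIV" by (rule orthonormal_Basis)+
    have \<nu>: "bilinear \<nu>"
      using bilinear_mu_bar[of t] g h unfolding \<nu>_def bilinear_def linear_iff by simp
    have "nil_ricci \<nu> v = ip (c *\<^sub>R g v + D (g v)) (g v)"
      unfolding nil_ricci_orthonormal[OF \<nu> on] ric sum_Basis_vec \<nu>ip ge power2_eq_square ..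
    also have "\<dots> = c * (v \<bullet> v) + h (D (g v)) \<bullet> v"
      by (simp add: linear_add[OF lin(1)] linear_cmul[OF lin(1)] flip: isom) (simp add: gh)
    finally show "nil_ricci \<nu> v = c * (v \<bullet> v) + h (D (g v)) \<bullet> v" .
  qed
qed

section \<open>The Ricci tensor of a left invariant metric\<close>

lemma levi_civita_inner:
  assumes br: "bilinear br"
  shows "levi_civita br X Y \<bullet> Z = (br X Y \<bullet> Z - br Y Z \<bullet> X + br Z X \<bullet> Y) / 2"
proof -
  define f where "f Z = (br X Y \<bullet> Z - br Y Z \<bullet> X + br Z X \<bullet> Y) / 2" for Z
  have f: "linear f"
    using br unfolding f_def bilinear_def linear_iff
    by (simp add: inner_left_distrib inner_right_distrib field_simps)
  have "levi_civita br X Y \<bullet> Z = (\<Sum>b\<in>Basis. (Z \<bullet> b) * f b)"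
    unfolding levi_civita_def f_def[symmetric] inner_sum_left by (simp add: inner_commute mult.commute)
  also have "\<dots> = f (\<Sum>b\<in>Basis. (Z \<bullet> b) *\<^sub>R b)"
    by (simp add: linear_sum[OF f] linear_cmul[OF f])
  finally show ?thesis by (simp add: euclidean_representation f_def)
qed

text \<open>The vector \<open>H\<close> with \<open>H \<bullet> W = tr (ad W)\<close>.\<close>
definition mean_curvature :: "('a::euclidean_space \<Rightarrow> 'a \<Rightarrow> 'a) \<Rightarrow> 'a" where
  "mean_curvature br = (\<Sum>b\<in>Basis. (\<Sum>c\<in>Basis. br b c \<bullet> c) *\<^sub>R b)"

lemma mean_curvature_inner:
  assumes br: "bilinear br"
  shows "mean_curvature br \<bullet> W = (\<Sum>c\<in>Basis. br W c \<bullet> c)"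
proof -
  define f where "f W = (\<Sum>c\<in>Basis. br W c \<bullet> c)" for W
  have f: "linear f"
    using br unfolding f_def bilinear_def linear_iff
    by (simp add: inner_left_distrib sum.distrib sum_distrib_left)
  have "mean_curvature br \<bullet> W = (\<Sum>b\<in>Basis. (W \<bullet> b) * f b)"
    unfolding mean_curvature_def f_def[symmetric] inner_sum_left by (simp add: inner_commute mult.commute)
  also have "\<dots> = f (\<Sum>b\<in>Basis. (W \<bullet> b) *\<^sub>R b)"
    by (simp add: linear_sum[OF f] linear_cmul[OF f])
  finally show ?thesis by (simp add: euclidean_representation f_def)
qed

text \<open>The usual formula for the Ricci tensor of a left invariant metric: the Ricci form of
the nilpotent case, minus half the Killing form, minus the symmetric part of \<open>ad H\<close>.
Writing \<open>L = \<nabla> X\<close>, \<open>A = ad X\<close> and \<open>J\<close> for the skew operator with \<open>J b \<bullet> Z = [b, Z] \<bullet> X\<close>, the Koszul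
formula reads \<open>2 L = - A - A\<^sup>T - J\<close>, and everything reduces to traces of products of these three
operators.\<close>
lemma ricci_tensor_diagonal:
  assumes br: "bilinear br" and skew: "\<And>x y. br x y = - br y x"
  shows "ricci_tensor br X X = nil_ricci br X - 1/2 * (\<Sum>b\<in>Basis. br X (br X b) \<bullet> b) - br (mean_curvature br) X \<bullet> X"
proof -
  define A where "A = br X"
  define L where "L b = levi_civita br b X" for b
  define J where "J b = (\<Sum>c\<in>Basis. (br b c \<bullet> X) *\<^sub>R c)" for b
  have lin: "linear (\<lambda>x. br x y)" "linear (br x)" for x y using br by (simp_all add: bilinear_def)
  have self: "br x x = 0" for x using skew[of x x] by (simp add: eq_neg_iff_add_eq_0 flip: scaleR_2)
  have A: "linear A" unfolding A_def by (rule lin)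
  have Jinner: "J b \<bullet> Z = br b Z \<bullet> X" for b Z
  proof -
    have l: "linear (\<lambda>Z. br b Z \<bullet> X)" using lin(2)[of b] unfolding linear_iff by (simp add: inner_left_distrib)
    have "J b \<bullet> Z = (\<Sum>c\<in>Basis. (Z \<bullet> c) * (br b c \<bullet> X))"
      unfolding J_def inner_sum_left by (simp add: inner_commute mult.commute)
    also have "\<dots> = br b (\<Sum>c\<in>Basis. (Z \<bullet> c) *\<^sub>R c) \<bullet> X"
      by (simp only: linear_sum[OF lin(2)] linear_cmul[OF lin(2)] inner_sum_left inner_scaleR_left)
    finally show ?thesis by (simp add: euclidean_representation)
  qed
  have J: "linear J"
  proof (rule linearI)
    show "J (x + y) = J x + J y" for x y
      unfolding J_def linear_add[OF lin(1)] inner_add_left scaleR_add_left sum.distrib ..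
    show "J (r *\<^sub>R x) = r *\<^sub>R J x" for r x
      unfolding J_def linear_cmul[OF lin(1)] inner_scaleR_left scaleR_sum_right scaleR_scaleR ..
  qed
  note lc = levi_civita_inner[OF br]
  have Linner: "L b \<bullet> Z = (- (A b \<bullet> Z) - b \<bullet> A Z - J b \<bullet> Z) / 2" for b Z
    unfolding L_def lc A_def Jinner skew[of b X] skew[of Z b] by (simp add: inner_commute)
  have L: "linear L"
  proof (rule linearI)
    show "L (x + y) = L x + L y" for x y
      by (rule vector_eq_rdot[THEN iffD1]) (auto simp: Linner inner_add_left linear_add[OF A] linear_add[OF J] field_simps)
    show "L (r *\<^sub>R x) = r *\<^sub>R L x" for r x
      by (rule vector_eq_rdot[THEN iffD1]) (auto simp: Linner linear_cmul[OF A] linear_cmul[OF J] field_simps)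
  qed
  define a where "a = (\<Sum>b\<in>Basis. A b \<bullet> A b)"
  define q where "q = (\<Sum>b\<in>Basis. A (A b) \<bullet> b)"
  define r where "r = (\<Sum>b\<in>Basis. J b \<bullet> A b)"
  define s where "s = (\<Sum>b\<in>Basis. J b \<bullet> J b)"
  have JA: "(\<Sum>b\<in>Basis. J (A b) \<bullet> b) = - r"
    unfolding r_def sum_negf[symmetric] Jinner by (intro sum.cong refl) (metis inner_minus_left skew)
  have AJ: "(\<Sum>b\<in>Basis. A (J b) \<bullet> b) = - r"
    using trace_commute[OF A J] JA by simp
  have LA: "(\<Sum>b\<in>Basis. L (A b) \<bullet> b) = (- q - a + r) / 2"
  proof -
    have "(\<Sum>b\<in>Basis. L (A b) \<bullet> b) = (- (\<Sum>b\<in>Basis. A (A b) \<bullet> b) - (\<Sum>b\<in>Basis. A b \<bullet> A b) - (\<Sum>b\<in>Basis. J (A b) \<bullet> b)) / 2"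
      unfolding Linner sum_divide_distrib[symmetric] sum_subtractf sum_negf ..
    then show ?thesis unfolding JA a_def q_def by simp
  qed
  have AL: "(\<Sum>b\<in>Basis. A (L b) \<bullet> b) = (- q - a + r) / 2"
    using trace_commute[OF A L] LA by simp
  have LAi: "(\<Sum>b\<in>Basis. L b \<bullet> A b) = (- a - q - r) / 2"
  proof -
    have "(\<Sum>b\<in>Basis. L b \<bullet> A b) = (- (\<Sum>b\<in>Basis. A b \<bullet> A b) - (\<Sum>b\<in>Basis. A (A b) \<bullet> b) - (\<Sum>b\<in>Basis. J b \<bullet> A b)) / 2"
      unfolding Linner sum_divide_distrib[symmetric] sum_subtractf sum_negf inner_commute[of "_ :: 'a" "A (A _)"] ..
    then show ?thesis unfolding a_def q_def r_def by simp
  qed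
  have LJ: "(\<Sum>b\<in>Basis. L b \<bullet> J b) = - s / 2"
  proof -
    have "(\<Sum>b\<in>Basis. L b \<bullet> J b) = (- (\<Sum>b\<in>Basis. J b \<bullet> A b) - (\<Sum>b\<in>Basis. A (J b) \<bullet> b) - (\<Sum>b\<in>Basis. J b \<bullet> J b)) / 2"
      unfolding Linner sum_divide_distrib[symmetric] sum_subtractf sum_negf inner_commute[of "_ :: 'a" "A (J _)"]
        inner_commute[of "A _" "J _"] ..
    then show ?thesis unfolding AJ r_def s_def by simp
  qed
  have W: "(\<Sum>b\<in>Basis. levi_civita br b (levi_civita br X X) \<bullet> b) = - (br (mean_curvature br) X \<bullet> X)"
  proof -
    let ?W = "levi_civita br X X"
    have "levi_civita br b ?W \<bullet> b = - (br ?W b \<bullet> b)" for b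
      unfolding lc[of b] self skew[of b ?W] by simp
    then have "(\<Sum>b\<in>Basis. levi_civita br b ?W \<bullet> b) = - (mean_curvature br \<bullet> ?W)"
      by (simp add: mean_curvature_inner[OF br] sum_negf)
    also have "mean_curvature br \<bullet> ?W = br (mean_curvature br) X \<bullet> X"
      unfolding inner_commute[of "mean_curvature br"] lc self skew[of X "mean_curvature br"] by simp
    finally show ?thesis .
  qed
  have XL: "levi_civita br X (L b) \<bullet> b = (A (L b) \<bullet> b + L b \<bullet> J b - L b \<bullet> A b) / 2" for b
    unfolding lc[of X] A_def[symmetric] skew[of "L b" b] skew[of b X]
    using Jinner[of b "L b"] by (simp add: A_def inner_commute)
  have brX: "levi_civita br (br b X) X = - L (A b)" for b
    unfolding L_def[symmetric] skew[of b X] A_def linear_neg[OF L] ..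
  have "ricci_tensor br X X = (\<Sum>b\<in>Basis. levi_civita br b (levi_civita br X X) \<bullet> b)
      - (\<Sum>b\<in>Basis. levi_civita br X (L b) \<bullet> b) + (\<Sum>b\<in>Basis. L (A b) \<bullet> b)"
    unfolding ricci_tensor_def riemann_curvature_def brX unfolding L_def[symmetric]
    by (simp add: inner_diff_left inner_add_left sum_subtractf sum.distrib)
  also have "(\<Sum>b\<in>Basis. levi_civita br X (L b) \<bullet> b)
     = ((\<Sum>b\<in>Basis. A (L b) \<bullet> b) + (\<Sum>b\<in>Basis. L b \<bullet> J b) - (\<Sum>b\<in>Basis. L b \<bullet> A b)) / 2"
    unfolding XL sum_divide_distrib[symmetric] sum_subtractf sum.distrib ..
  finally have *: "ricci_tensor br X X = - a / 2 + s / 4 - q / 2 - br (mean_curvature br) X \<bullet> X"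
    unfolding W AL LJ LAi LA by (simp add: field_simps)
  have "s = (\<Sum>b\<in>Basis. \<Sum>c\<in>Basis. (br b c \<bullet> X)\<^sup>2)"
    unfolding s_def Jinner[symmetric] by (simp add: orthonormal_sum_squares[OF orthonormal_Basis(1)] orthonormal_Basis(2))
  then show ?thesis unfolding * nil_ricci_def a_def q_def A_def by simp
qed

section \<open>Standard Einstein solvmanifolds\<close>

text \<open>The sum is the trace of the Ricci operator against \<open>[D, D\<^sup>T]\<close>. With
\<open>\<pi>(F) \<nu> = F \<circ> \<nu> - \<nu>(F _, _) - \<nu>(_, F _)\<close>, the moment map property gives a quarter of
\<open>\<langle>\<pi>([D, D\<^sup>T]) \<nu>, \<nu>\<rangle> = |\<pi>(D\<^sup>T) \<nu>|\<^sup>2 - |\<pi>(D) \<nu>|\<^sup>2\<close>, and \<open>\<pi>(D) \<nu> = 0\<close> for a derivation.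
The proof expands both squares; the cross terms agree since \<open>D\<close> and \<open>D\<^sup>T\<close> are adjoint.\<close>
lemma sum_nil_ricci_derivation_ge_adjoint:
  fixes \<nu> :: "'a::euclidean_space \<Rightarrow> 'a \<Rightarrow> 'a"
  assumes \<nu>: "bilinear \<nu>" and skew: "\<And>x y. \<nu> x y = - \<nu> y x"
    and D: "linear D" and der: "\<And>x y. D (\<nu> x y) = \<nu> (D x) y + \<nu> x (D y)"
  shows "(\<Sum>b\<in>Basis. nil_ricci \<nu> (D b) - nil_ricci \<nu> (adjoint D b)) \<ge> 0"
proof -
  define A where "A = adjoint D"
  have A: "linear A" unfolding A_def by (rule adjoint_linear[OF D])
  have DA: "adjoint A = D" unfolding A_def by (rule adjoint_adjoint[OF D])
  have lin: "linear (\<lambda>x. \<nu> x y)" "linear (\<nu> x)" for x y using \<nu> by (simp_all add: bilinear_def)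
  have lin3: "linear (\<lambda>x. F (\<nu> x y))" if "linear F" for F y
    using lin that unfolding linear_iff by simp
  have sq: "(\<Sum>b\<in>Basis. (y \<bullet> F b)\<^sup>2) = adjoint F y \<bullet> adjoint F y" if "linear F" for F :: "'a \<Rightarrow> 'a" and y
    using orthonormal_sum_squares[OF orthonormal_Basis(1), of "adjoint F y"] orthonormal_Basis(2)
    by (simp add: adjoint_clauses[OF that] inner_commute)
  define S :: "('a \<Rightarrow> 'a \<Rightarrow> real) \<Rightarrow> real" where "S g = (\<Sum>b\<in>Basis. \<Sum>c\<in>Basis. g b c)" for g
  have S_add: "S (\<lambda>b c. f b c + g b c) = S f + S g" and S_diff: "S (\<lambda>b c. f b c - g b c) = S f - S g"
    and S_mult: "S (\<lambda>b c. k * f b c) = k * S f" for f g k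
    unfolding S_def by (simp_all add: sum.distrib sum_subtractf sum_distrib_left)
  have S_swap: "S f = S (\<lambda>b c. f c b)" for f unfolding S_def by (rule sum.swap)
  have ric: "(\<Sum>b\<in>Basis. nil_ricci \<nu> (F b))
      = - 1/2 * S (\<lambda>b c. \<nu> (F b) c \<bullet> \<nu> (F b) c) + 1/4 * S (\<lambda>b c. adjoint F (\<nu> b c) \<bullet> adjoint F (\<nu> b c))"
    if F: "linear F" for F
  proof -
    have "(\<Sum>b\<in>Basis. nil_ricci \<nu> (F b)) = - 1/2 * S (\<lambda>b c. \<nu> (F b) c \<bullet> \<nu> (F b) c)
      + 1/4 * (\<Sum>a\<in>Basis. \<Sum>b\<in>Basis. \<Sum>c\<in>Basis. (\<nu> b c \<bullet> F a)\<^sup>2)"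
      unfolding nil_ricci_def S_def by (simp add: sum.distrib sum_subtractf sum_distrib_left sum_negf)
    also have "(\<Sum>a\<in>Basis. \<Sum>b\<in>Basis. \<Sum>c\<in>Basis. (\<nu> b c \<bullet> F a)\<^sup>2)
      = (\<Sum>b\<in>Basis. \<Sum>a\<in>Basis. \<Sum>c\<in>Basis. (\<nu> b c \<bullet> F a)\<^sup>2)" by (rule sum.swap)
    also have "\<dots> = (\<Sum>b\<in>Basis. \<Sum>c\<in>Basis. \<Sum>a\<in>Basis. (\<nu> b c \<bullet> F a)\<^sup>2)"
      by (rule sum.cong[OF refl], rule sum.swap)
    finally show ?thesis unfolding sq[OF F] S_def .
  qed
  have norm_eq: "S (\<lambda>b c. (F (\<nu> b c) - \<nu> (F b) c - \<nu> b (F c)) \<bullet> (F (\<nu> b c) - \<nu> (F b) c - \<nu> b (F c)))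
     = S (\<lambda>b c. F (\<nu> b c) \<bullet> F (\<nu> b c)) + 2 * S (\<lambda>b c. \<nu> (F b) c \<bullet> \<nu> (F b) c)
       - 4 * S (\<lambda>b c. F (\<nu> b c) \<bullet> \<nu> (F b) c) + 2 * S (\<lambda>b c. \<nu> (F b) c \<bullet> \<nu> b (F c))" (is "?n F = _")
    if F: "linear F" for F
  proof -
    have "?n F = S (\<lambda>b c. F (\<nu> b c) \<bullet> F (\<nu> b c)) + S (\<lambda>b c. \<nu> (F b) c \<bullet> \<nu> (F b) c)
       + S (\<lambda>b c. \<nu> b (F c) \<bullet> \<nu> b (F c)) - 2 * S (\<lambda>b c. F (\<nu> b c) \<bullet> \<nu> (F b) c)
       - 2 * S (\<lambda>b c. F (\<nu> b c) \<bullet> \<nu> b (F c)) + 2 * S (\<lambda>b c. \<nu> (F b) c \<bullet> \<nu> b (F c))"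
      unfolding S_add[symmetric] S_diff[symmetric] S_mult[symmetric]
      by (simp add: inner_diff_left inner_diff_right inner_commute algebra_simps)
    moreover have "S (\<lambda>b c. \<nu> b (F c) \<bullet> \<nu> b (F c)) = S (\<lambda>b c. \<nu> (F b) c \<bullet> \<nu> (F b) c)"
      by (subst S_swap, subst (1 2) skew) simp
    moreover have "S (\<lambda>b c. F (\<nu> b c) \<bullet> \<nu> b (F c)) = S (\<lambda>b c. F (\<nu> b c) \<bullet> \<nu> (F b) c)"
      by (subst S_swap, subst (1 2) skew) (simp add: linear_neg[OF F])
    ultimately show ?thesis by simp
  qed
  have cross1: "S (\<lambda>b c. A (\<nu> b c) \<bullet> \<nu> (A b) c) = S (\<lambda>b c. D (\<nu> b c) \<bullet> \<nu> (D b) c)"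
  proof -
    have "S (\<lambda>b c. D (\<nu> b c) \<bullet> \<nu> (D b) c) = S (\<lambda>b c. \<nu> b c \<bullet> A (\<nu> (D b) c))"
      by (simp add: A_def adjoint_clauses[OF D])
    also have "\<dots> = S (\<lambda>c b. A (\<nu> (D b) c) \<bullet> \<nu> b c)" by (subst S_swap) (simp add: inner_commute)
    also have "\<dots> = S (\<lambda>c b. A (\<nu> b c) \<bullet> \<nu> (A b) c)"
      unfolding S_def A_def
      by (intro sum.cong refl sum_Basis_adjoint[OF _ D] bilinear_inner[OF lin3 lin(1)] adjoint_linear D)
    also have "\<dots> = S (\<lambda>b c. A (\<nu> b c) \<bullet> \<nu> (A b) c)" by (rule S_swap)
    finally show ?thesis ..
  qed
  have cross2: "S (\<lambda>b c. \<nu> (A b) c \<bullet> \<nu> b (A c)) = S (\<lambda>b c. \<nu> (D b) c \<bullet> \<nu> b (D c))"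
  proof -
    have "S (\<lambda>b c. \<nu> (D b) c \<bullet> \<nu> b (D c)) = S (\<lambda>c b. \<nu> (D b) c \<bullet> \<nu> b (D c))" by (rule S_swap)
    also have "\<dots> = S (\<lambda>c b. \<nu> b c \<bullet> \<nu> (A b) (D c))"
      unfolding S_def A_def
      by (intro sum.cong refl sum_Basis_adjoint[OF _ D] bilinear_inner lin)
    also have "\<dots> = S (\<lambda>b c. \<nu> (A b) (D c) \<bullet> \<nu> b c)" by (subst S_swap) (simp add: inner_commute)
    also have "\<dots> = S (\<lambda>b c. \<nu> (A b) c \<bullet> \<nu> b (A c))"
      unfolding S_def A_def
      by (intro sum.cong refl sum_Basis_adjoint[OF _ D] bilinear_inner lin)
    finally show ?thesis ..
  qed
  have "0 \<le> S (\<lambda>b c. (A (\<nu> b c) - \<nu> (A b) c - \<nu> b (A c)) \<bullet> (A (\<nu> b c) - \<nu> (A b) c - \<nu> b (A c)))"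
    unfolding S_def by (intro sum_nonneg) simp
  moreover have "S (\<lambda>b c. (D (\<nu> b c) - \<nu> (D b) c - \<nu> b (D c)) \<bullet> (D (\<nu> b c) - \<nu> (D b) c - \<nu> b (D c))) = 0"
    unfolding S_def der by simp
  ultimately show ?thesis
    unfolding norm_eq[OF A] norm_eq[OF D] cross1 cross2 sum_subtractf ric[OF D] ric[OF A, unfolded A_def]
    unfolding ric[OF A, folded A_def] A_def[symmetric] DA by simp
qed

text \<open>An argument of Heber and Lauret that the derivations of a standard Einstein extension are normal, at
least on the average. Put \<open>T = \<Sum> [D l, (D l)\<^sup>T]\<close>; the hypothesis says \<open>Ric + T / 2 = c + H\<close> as quadratic
forms. Taking the trace against \<open>T\<close>, the right-hand side gives 0 because \<open>H\<close> commutes with every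
\<open>D l\<close>, and on the left the trace of \<open>Ric T\<close> is nonnegative by the preceding lemma. So
the trace of \<open>T\<^sup>2\<close> is not positive, and \<open>T = 0\<close>. Traces of the form \<open>tr (M [D, D\<^sup>T])\<close> are
obtained by evaluating quadratic forms at \<open>D b\<close> and \<open>D\<^sup>T b\<close> and summing over the basis.\<close>
lemma nilsoliton_of_extension:
  fixes \<nu> :: "'a::euclidean_space \<Rightarrow> 'a \<Rightarrow> 'a" and D :: "'l \<Rightarrow> 'a \<Rightarrow> 'a"
  assumes \<nu>: "bilinear \<nu>" and skew: "\<And>x y. \<nu> x y = - \<nu> y x" and L: "finite L"
    and D: "\<And>l. l \<in> L \<Longrightarrow> linear (D l)"
    and der: "\<And>l x y. l \<in> L \<Longrightarrow> D l (\<nu> x y) = \<nu> (D l x) y + \<nu> x (D l y)"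
    and H: "linear H" and comm: "\<And>l x. l \<in> L \<Longrightarrow> D l (H x) = H (D l x)"
    and eq: "\<And>x. nil_ricci \<nu> x + 1/2 * (\<Sum>l\<in>L. adjoint (D l) x \<bullet> adjoint (D l) x - D l x \<bullet> D l x)
        = c * (x \<bullet> x) + H x \<bullet> x"
  shows "nil_ricci \<nu> x = c * (x \<bullet> x) + H x \<bullet> x"
proof -
  define A where "A l = adjoint (D l)" for l
  have A: "linear (A l)" if "l \<in> L" for l unfolding A_def by (rule adjoint_linear[OF D[OF that]])
  note adj = adjoint_clauses[OF D, folded A_def]
  define T where "T x = (\<Sum>l\<in>L. D l (A l x) - A l (D l x))" for x
  have T: "linear T"
    unfolding T_def using D A
    by (intro linear_compose_sum ballI linear_compose_sub linear_compose[of "A _" "D _", unfolded o_def] linear_compose[of "D _" "A _", unfolded o_def]) auto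
  have Tsym: "T x \<bullet> y = x \<bullet> T y" for x y
    unfolding T_def inner_sum_left inner_sum_right
  proof (intro sum.cong refl)
    fix l assume l: "l \<in> L"
    have "D l (A l x) \<bullet> y = x \<bullet> D l (A l y)" "A l (D l x) \<bullet> y = x \<bullet> A l (D l y)"
      by (metis adj l)+
    then show "(D l (A l x) - A l (D l x)) \<bullet> y = x \<bullet> (D l (A l y) - A l (D l y))"
      by (simp add: inner_diff_left inner_diff_right)
  qed
  have Tq: "T x \<bullet> x = (\<Sum>l\<in>L. A l x \<bullet> A l x - D l x \<bullet> D l x)" for x
    unfolding T_def inner_sum_left
  proof (intro sum.cong refl)
    fix l assume l: "l \<in> L"
    have "D l (A l x) \<bullet> x = A l x \<bullet> A l x" "A l (D l x) \<bullet> x = D l x \<bullet> D l x"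
      by (metis adj l)+
    then show "(D l (A l x) - A l (D l x)) \<bullet> x = A l x \<bullet> A l x - D l x \<bullet> D l x"
      by (simp add: inner_diff_left)
  qed
  have ric: "nil_ricci \<nu> x = c * (x \<bullet> x) + H x \<bullet> x - 1/2 * (T x \<bullet> x)" for x
    using eq[of x] unfolding Tq A_def by linarith
  have quad: "(\<Sum>b\<in>Basis. F (D l b) \<bullet> D l b) = (\<Sum>b\<in>Basis. F (D l (A l b)) \<bullet> b)"
      "(\<Sum>b\<in>Basis. F (A l b) \<bullet> A l b) = (\<Sum>b\<in>Basis. F (A l (D l b)) \<bullet> b)"
    if l: "l \<in> L" and F: "linear F" for l F
  proof -
    note cc = linear_compose[of _ F, unfolded o_def, OF _ F]
    have "(\<Sum>b\<in>Basis. F (D l b) \<bullet> D l b) = (\<Sum>b\<in>Basis. A l (F (D l b)) \<bullet> b)"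
      by (simp add: adj l)
    also have "\<dots> = (\<Sum>b\<in>Basis. F (D l (A l b)) \<bullet> b)"
      by (rule trace_commute[OF A[OF l] cc[OF D[OF l]]])
    finally show "(\<Sum>b\<in>Basis. F (D l b) \<bullet> D l b) = (\<Sum>b\<in>Basis. F (D l (A l b)) \<bullet> b)" .
    have "(\<Sum>b\<in>Basis. F (A l b) \<bullet> A l b) = (\<Sum>b\<in>Basis. D l (F (A l b)) \<bullet> b)"
      by (simp add: adj l)
    also have "\<dots> = (\<Sum>b\<in>Basis. F (A l (D l b)) \<bullet> b)"
      by (rule trace_commute[OF D[OF l] cc[OF A[OF l]]])
    finally show "(\<Sum>b\<in>Basis. F (A l b) \<bullet> A l b) = (\<Sum>b\<in>Basis. F (A l (D l b)) \<bullet> b)" .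
  qed
  have 1: "(\<Sum>b\<in>Basis. D l b \<bullet> D l b) = (\<Sum>b\<in>Basis. A l b \<bullet> A l b)" if l: "l \<in> L" for l
    using quad[OF l linear_id[unfolded id_def]] trace_commute[OF D[OF l] A[OF l]] by simp
  have 2: "(\<Sum>b\<in>Basis. H (D l b) \<bullet> D l b) = (\<Sum>b\<in>Basis. H (A l b) \<bullet> A l b)" if l: "l \<in> L" for l
  proof -
    have "(\<Sum>b\<in>Basis. H (A l b) \<bullet> A l b) = (\<Sum>b\<in>Basis. D l (H (A l b)) \<bullet> b)"
      by (simp add: adj l)
    also have "\<dots> = (\<Sum>b\<in>Basis. H (D l (A l b)) \<bullet> b)" by (simp add: comm l)
    finally show ?thesis using quad(1)[OF l H] by simp
  qed
  have "0 \<le> (\<Sum>l\<in>L. \<Sum>b\<in>Basis. nil_ricci \<nu> (D l b) - nil_ricci \<nu> (A l b))"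
    unfolding A_def by (rule sum_nonneg, rule sum_nil_ricci_derivation_ge_adjoint[OF \<nu> skew]) (simp_all add: D der)
  also have "\<dots> = (\<Sum>l\<in>L. - 1/2 * ((\<Sum>b\<in>Basis. T (D l b) \<bullet> D l b) - (\<Sum>b\<in>Basis. T (A l b) \<bullet> A l b)))"
  proof (rule sum.cong[OF refl])
    fix l assume l: "l \<in> L"
    have s: "(\<Sum>b\<in>Basis. nil_ricci \<nu> (F b)) = c * (\<Sum>b\<in>Basis. F b \<bullet> F b) + (\<Sum>b\<in>Basis. H (F b) \<bullet> F b)
        - 1/2 * (\<Sum>b\<in>Basis. T (F b) \<bullet> F b)" for F
      unfolding ric by (simp only: sum_subtractf sum.distrib sum_distrib_left)
    show "(\<Sum>b\<in>Basis. nil_ricci \<nu> (D l b) - nil_ricci \<nu> (A l b))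
      = - 1/2 * ((\<Sum>b\<in>Basis. T (D l b) \<bullet> D l b) - (\<Sum>b\<in>Basis. T (A l b) \<bullet> A l b))"
      unfolding sum_subtractf s 1[OF l] 2[OF l] by (simp add: field_simps)
  qed
  also have "\<dots> = - 1/2 * (\<Sum>b\<in>Basis. T (T b) \<bullet> b)"
  proof -
    have TT: "T (T b) \<bullet> b = (\<Sum>l\<in>L. T (D l (A l b)) \<bullet> b - T (A l (D l b)) \<bullet> b)" for b
    proof -
      have "T (T b) = T (\<Sum>l\<in>L. D l (A l b) - A l (D l b))" by (simp only: T_def[of b])
      also have "\<dots> = (\<Sum>l\<in>L. T (D l (A l b)) - T (A l (D l b)))"
        by (simp only: linear_sum[OF T] linear_diff[OF T])
      finally show ?thesis by (simp only: inner_sum_left inner_diff_left)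
    qed
    have "(\<Sum>b\<in>Basis. T (T b) \<bullet> b) = (\<Sum>l\<in>L. \<Sum>b\<in>Basis. T (D l (A l b)) \<bullet> b - T (A l (D l b)) \<bullet> b)"
      unfolding TT by (rule sum.swap)
    also have "\<dots> = (\<Sum>l\<in>L. (\<Sum>b\<in>Basis. T (D l b) \<bullet> D l b) - (\<Sum>b\<in>Basis. T (A l b) \<bullet> A l b))"
      by (intro sum.cong refl) (simp only: quad[OF _ T] sum_subtractf)
    finally show ?thesis by (simp only: sum_distrib_left)
  qed
  also have "\<dots> = - 1/2 * (\<Sum>b\<in>Basis. T b \<bullet> T b)" by (simp add: Tsym)
  finally have "(\<Sum>b\<in>Basis. T b \<bullet> T b) \<le> 0" by simp
  then have "(\<Sum>b\<in>Basis. T b \<bullet> T b) = 0" by (meson antisym inner_ge_zero sum_nonneg)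
  then have T0: "T b = 0" if "b \<in> Basis" for b
    using that by (subst (asm) sum_nonneg_eq_0_iff) auto
  have "T x = 0" 
    using linear_eq_stdbasis[OF T linear_zero] T0 by (metis)
  then show ?thesis using ric[of x] by simp
qed

text \<open>On the nilradical \<open>N\<close> the Killing term vanishes, since \<open>ad X\<close> maps into \<open>N\<close> and \<open>(ad X)^2\<close> kills \<open>N\<close> for
\<open>X \<in> N\<close>. The brackets with an orthonormal basis \<open>L\<close> of the orthogonal complement of \<open>N\<close> contribute half of
\<open>\<Sum> [D l, (D l)\<^sup>T]\<close> with \<open>D l = ad l\<close> restricted to \<open>N\<close>. The mean curvature vector lies in the complement,
which is abelian, so its derivation commutes with the \<open>D l\<close>. This is the situation of the extension
lemma, with \<open>N\<close> identified isometrically with the standard Euclidean space by \<open>\<psi>\<close>.\<close>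
lemma not_einstein_nilradical:
  assumes t: "t > 0"
  shows "\<not> einstein_nilradical TYPE('s::euclidean_space) (mu_bar t)"
proof
  assume "einstein_nilradical TYPE('s) (mu_bar t)"
  then obtain br :: "'s \<Rightarrow> 's \<Rightarrow> 's" and N where S: "standard_einstein_solvmanifold br N"
      and iso: "lie_isomorphic_onto (mu_bar t) br N"
    unfolding einstein_nilradical_def by blast
  obtain \<phi> where \<phi>: "linear \<phi>" "bij_betw \<phi> UNIV N" and \<phi>hom: "\<And>x y. \<phi> (mu_bar t x y) = br (\<phi> x) (\<phi> y)"
    using iso unfolding lie_isomorphic_onto_def by blast
  have lie: "lie_algebra br" and "is_nilradical br N" and ein: "is_einstein br"
    and ab: "\<And>x y. x \<in> orthogonal_comp N \<Longrightarrow> y \<in> orthogonal_comp N \<Longrightarrow> br x y = 0"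
    using S unfolding standard_einstein_solvmanifold_def by blast+
  then have N: "subspace N" and ideal: "\<And>x y. y \<in> N \<Longrightarrow> br x y \<in> N"
    unfolding is_nilradical_def lie_ideal_def by blast+
  have br: "bilinear br" and alt: "\<And>x. br x x = 0"
    and jacobi: "\<And>x y z. br x (br y z) + br y (br z x) + br z (br x y) = 0"
    using lie unfolding lie_algebra_def by blast+
  have lin: "linear (\<lambda>x. br x y)" "linear (br x)" for x y using br by (simp_all add: bilinear_def)
  have skew: "br x y = - br y x" for x y
  proof -
    have "br x y + br y x = br (x + y) (x + y)"
      unfolding linear_add[OF lin(1)] linear_add[OF lin(2)] by (simp only: alt) simp
    then show ?thesis by (simp add: alt eq_neg_iff_add_eq_0)
  qed
  have ad_der: "br l (br y z) = br (br l y) z + br y (br l z)" for l y z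
    using jacobi[of l y z] skew[of z l] skew[of z "br l y"]
    by (simp add: linear_neg[OF lin(2)] algebra_simps eq_neg_iff_add_eq_0)
  obtain c where c: "\<And>X Y. ricci_tensor br X Y = c * (X \<bullet> Y)" using ein unfolding is_einstein_def by blast

  have inj\<phi>: "inj \<phi>" and range\<phi>: "range \<phi> = N" using \<phi>(2) by (auto simp: bij_betw_def)
  have "dim (UNIV :: (real^9) set) = dim N"
    using dim_image_eq[OF \<phi>(1), of UNIV] inj\<phi> range\<phi> by simp
  then obtain \<psi> :: "real^9 \<Rightarrow> 's" and \<pi> where \<psi>: "linear \<psi>" "\<psi> ` UNIV = N" and \<pi>: "linear \<pi>"
    and norm\<psi>: "\<And>x. norm (\<psi> x) = norm x" and \<pi>\<psi>: "\<And>x. \<pi> (\<psi> x) = x" and \<psi>\<pi>: "\<And>y. y \<in> N \<Longrightarrow> \<psi> (\<pi> y) = y"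
    using isometries_subspaces[OF subspace_UNIV N] by (metis UNIV_I)
  have isom: "\<psi> x \<bullet> \<psi> y = x \<bullet> y" for x y
    unfolding dot_norm linear_add[OF \<psi>(1), symmetric] norm\<psi> ..
  have \<psi>N: "\<psi> x \<in> N" for x using \<psi>(2) by blast
  have inj\<psi>: "inj \<psi>" by (metis \<pi>\<psi> injI)

  define \<nu> where "\<nu> x y = \<pi> (br (\<psi> x) (\<psi> y))" for x y
  define D where "D l x = \<pi> (br l (\<psi> x))" for l x
  have \<psi>\<nu>: "\<psi> (\<nu> x y) = br (\<psi> x) (\<psi> y)" for x y unfolding \<nu>_def by (rule \<psi>\<pi>[OF ideal[OF \<psi>N]])
  have \<psi>D: "\<psi> (D l x) = br l (\<psi> x)" for l x unfolding D_def by (rule \<psi>\<pi>[OF ideal[OF \<psi>N]])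
  have \<nu>: "bilinear \<nu>" using br \<psi>(1) \<pi> unfolding \<nu>_def bilinear_def linear_iff by simp
  have \<nu>skew: "\<nu> x y = - \<nu> y x" for x y
    unfolding \<nu>_def by (subst skew) (rule linear_neg[OF \<pi>])
  have D: "linear (D l)" for l using br \<psi>(1) \<pi> unfolding D_def bilinear_def linear_iff by simp
  have Dder: "D l (\<nu> x y) = \<nu> (D l x) y + \<nu> x (D l y)" for l x y
    by (rule injD[OF inj\<psi>]) (simp only: \<psi>D \<psi>\<nu> linear_add[OF \<psi>(1)] ad_der[of l])

  define g where "g x = inv \<phi> (\<psi> x)" for x
  have \<phi>g: "\<phi> (g x) = \<psi> x" for x
    unfolding g_def using \<psi>N range\<phi> by (metis f_inv_into_f)
  have g: "linear g"
    by (rule linearI; rule injD[OF inj\<phi>])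
      (simp_all add: \<phi>g linear_add[OF \<phi>(1)] linear_cmul[OF \<phi>(1)] linear_add[OF \<psi>(1)] linear_cmul[OF \<psi>(1)])
  have "inj g" by (metis \<phi>g inj\<psi> injD injI)
  then have gbij: "bij g" using linear_injective_imp_surjective[OF g] by (simp add: bij_def)
  have ghom: "g (\<nu> x y) = mu_bar t (g x) (g y)" for x y
    by (rule injD[OF inj\<phi>]) (simp add: \<phi>g \<psi>\<nu> \<phi>hom)
  have \<nu>\<nu>: "\<nu> x (\<nu> y z) = 0" for x y z
    by (rule injD[OF \<open>inj g\<close>]) (simp add: ghom mu_bar_two_step linear_0[OF g])

  define A where "A = \<psi> ` Basis"
  have sumA: "(\<Sum>a\<in>A. f a) = (\<Sum>b\<in>Basis. f (\<psi> b))" for f :: "'s \<Rightarrow> real"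
    unfolding A_def by (rule sum.reindex_cong[OF inj_on_subset[OF inj\<psi> subset_UNIV] refl refl])
  have A: "orthonormal A"
    unfolding orthonormal_def A_def by (auto simp: isom inner_Basis dest: injD[OF inj\<psi>])
  have spanA: "span A = N"
    unfolding A_def linear_span_image[OF \<psi>(1)] span_Basis \<psi>(2) ..
  obtain L where L: "orthonormal (A \<union> L)" "A \<inter> L = {}" "span (A \<union> L) = UNIV"
      and AL: "\<And>a l. a \<in> A \<Longrightarrow> l \<in> L \<Longrightarrow> a \<bullet> l = 0"
    using orthonormal_extend[OF A, of UNIV] by auto
  have finA: "finite A" and finL: "finite L" using L(1) by (simp_all add: orthonormal_def)
  have NL: "x \<bullet> l = 0" if "x \<in> N" "l \<in> L" for x l
    using orthogonal_to_span[of x A l] AL[OF _ that(2)] that(1) unfolding spanA by (auto simp: orthogonal_def inner_commute)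
  have Lperp: "l \<in> orthogonal_comp N" if "l \<in> L" for l
    using NL[OF _ that] by (simp add: orthogonal_comp_def orthogonal_def)
  note split = sum.union_disjoint[OF finA finL L(2)]
  have tr: "(\<Sum>b\<in>Basis. F b \<bullet> b) = (\<Sum>b\<in>A. F b \<bullet> b) + (\<Sum>b\<in>L. F b \<bullet> b)" if F: "linear F" for F
    unfolding split[symmetric]
    by (rule trace_basis_independent[OF bilinear_inner[OF F linear_id[unfolded id_def]] orthonormal_Basis(1) L(1)])
      (simp add: L(3))
  have NN: "x \<in> N \<Longrightarrow> br x y \<in> N" for x y using ideal[of x y] skew[of x y] subspace_neg[OF N] by metis

  define H where "H = mean_curvature br"
  have H0: "H \<bullet> \<psi> x = 0" for x
  proof -
    have "(\<Sum>b\<in>L. br (\<psi> x) b \<bullet> b) = 0" by (intro sum.neutral ballI NL NN \<psi>N)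
    moreover have "(\<Sum>b\<in>A. br (\<psi> x) b \<bullet> b) = (\<Sum>b\<in>Basis. \<nu> x b \<bullet> b)"
      unfolding sumA \<psi>\<nu>[symmetric] isom ..
    moreover have "(\<Sum>b\<in>Basis. \<nu> x b \<bullet> b) = 0"
      by (rule trace_eq_0_of_square_zero) (use \<nu> \<nu>\<nu> in \<open>simp_all add: bilinear_def\<close>)
    ultimately show ?thesis unfolding H_def mean_curvature_inner[OF br] tr[OF lin(2)] by simp
  qed
  have "H \<in> orthogonal_comp N"
    unfolding orthogonal_comp_def orthogonal_def using H0 \<psi>(2) by (auto simp: inner_commute)
  then have comm: "D l (D H x) = D H (D l x)" if "l \<in> L" for l x
    using ad_der[of l H "\<psi> x"] ab[OF Lperp[OF that]] linear_0[OF lin(1)]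
    by (intro injD[OF inj\<psi>]) (simp add: \<psi>D)

  have killing: "(\<Sum>b\<in>Basis. br (\<psi> x) (br (\<psi> x) b) \<bullet> b) = 0" for x
  proof -
    have F: "linear (\<lambda>b. br (\<psi> x) (br (\<psi> x) b))" using lin(2) unfolding linear_iff by simp
    have "(\<Sum>b\<in>L. br (\<psi> x) (br (\<psi> x) b) \<bullet> b) = 0" by (intro sum.neutral ballI NL NN \<psi>N)
    moreover have "(\<Sum>b\<in>A. br (\<psi> x) (br (\<psi> x) b) \<bullet> b) = 0"
      unfolding sumA \<psi>\<nu>[symmetric] \<nu>\<nu> by (simp add: linear_0[OF \<psi>(1)])
    ultimately show ?thesis unfolding tr[OF F] by simp
  qed

  have ricci: "nil_ricci br (\<psi> x) = nil_ricci \<nu> x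
      + 1/2 * (\<Sum>l\<in>L. adjoint (D l) x \<bullet> adjoint (D l) x - D l x \<bullet> D l x)" for x
  proof -
    have b1: "(\<Sum>b\<in>A \<union> L. \<Sum>c\<in>A \<union> L. (br (\<psi> x) b \<bullet> c)\<^sup>2) = (\<Sum>b\<in>Basis. \<nu> x b \<bullet> \<nu> x b) + (\<Sum>l\<in>L. D l x \<bullet> D l x)"
    proof -
      have sq: "(\<Sum>c\<in>A \<union> L. (br (\<psi> x) b \<bullet> c)\<^sup>2) = br (\<psi> x) b \<bullet> br (\<psi> x) b" for b
        by (rule orthonormal_sum_squares[OF L(1)]) (simp add: L(3))
      have "br (\<psi> x) l \<bullet> br (\<psi> x) l = D l x \<bullet> D l x" for l
        unfolding skew[of "\<psi> x" l] inner_minus_left inner_minus_right minus_minus \<psi>D[symmetric] isom ..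
      then have "(\<Sum>b\<in>L. br (\<psi> x) b \<bullet> br (\<psi> x) b) = (\<Sum>l\<in>L. D l x \<bullet> D l x)" by simp
      moreover have "(\<Sum>b\<in>A. br (\<psi> x) b \<bullet> br (\<psi> x) b) = (\<Sum>b\<in>Basis. \<nu> x b \<bullet> \<nu> x b)"
        unfolding sumA \<psi>\<nu>[symmetric] isom ..
      ultimately show ?thesis unfolding sq split by simp
    qed
    have b2: "(\<Sum>b\<in>A \<union> L. \<Sum>c\<in>A \<union> L. (br b c \<bullet> \<psi> x)\<^sup>2)
      = (\<Sum>b\<in>Basis. \<Sum>c\<in>Basis. (\<nu> b c \<bullet> x)\<^sup>2) + 2 * (\<Sum>l\<in>L. adjoint (D l) x \<bullet> adjoint (D l) x)"
    proof -
      have Lb: "(\<Sum>b\<in>A. (br l b \<bullet> \<psi> x)\<^sup>2) = adjoint (D l) x \<bullet> adjoint (D l) x" for l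
      proof -
        have "(\<Sum>b\<in>A. (br l b \<bullet> \<psi> x)\<^sup>2) = (\<Sum>b\<in>Basis. (adjoint (D l) x \<bullet> b)\<^sup>2)"
          unfolding sumA \<psi>D[symmetric] isom adjoint_clauses[OF D] by (simp add: inner_commute)
        then show ?thesis using orthonormal_sum_squares[OF orthonormal_Basis(1), of "adjoint (D l) x"] by simp
      qed
      have sq: "(br b l \<bullet> \<psi> x)\<^sup>2 = (br l b \<bullet> \<psi> x)\<^sup>2" for b l by (subst skew) simp
      have AA: "(\<Sum>b\<in>A. \<Sum>c\<in>A. (br b c \<bullet> \<psi> x)\<^sup>2) = (\<Sum>b\<in>Basis. \<Sum>c\<in>Basis. (\<nu> b c \<bullet> x)\<^sup>2)"
        unfolding sumA \<psi>\<nu>[symmetric] isom ..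
      have LA: "(\<Sum>b\<in>L. \<Sum>c\<in>A. (br b c \<bullet> \<psi> x)\<^sup>2) = (\<Sum>l\<in>L. adjoint (D l) x \<bullet> adjoint (D l) x)"
        unfolding Lb ..
      have AL: "(\<Sum>b\<in>A. \<Sum>c\<in>L. (br b c \<bullet> \<psi> x)\<^sup>2) = (\<Sum>l\<in>L. adjoint (D l) x \<bullet> adjoint (D l) x)"
        unfolding LA[symmetric] by (subst sum.swap) (intro sum.cong refl sq)
      have LL: "(\<Sum>b\<in>L. \<Sum>c\<in>L. (br b c \<bullet> \<psi> x)\<^sup>2) = 0"
        using ab Lperp by (intro sum.neutral ballI) simp
      show ?thesis unfolding split sum.distrib AA LA AL LL by simp
    qed
    show ?thesis
      unfolding nil_ricci_orthonormal[OF br L(1,3)] b1 b2 unfolding nil_ricci_def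
      by (simp add: sum_subtractf field_simps)
  qed
  have eq: "nil_ricci \<nu> x + 1/2 * (\<Sum>l\<in>L. adjoint (D l) x \<bullet> adjoint (D l) x - D l x \<bullet> D l x)
      = c * (x \<bullet> x) + D H x \<bullet> x" for x
  proof -
    have "c * (x \<bullet> x) = nil_ricci br (\<psi> x) - br H (\<psi> x) \<bullet> \<psi> x"
      using ricci_tensor_diagonal[OF br skew, of "\<psi> x"] unfolding c killing isom H_def by simp
    also have "br H (\<psi> x) \<bullet> \<psi> x = D H x \<bullet> x" unfolding \<psi>D[symmetric] isom ..
    finally show ?thesis unfolding ricci by linarith
  qed
  have soliton: "nil_ricci \<nu> x = c * (x \<bullet> x) + D H x \<bullet> x" for x
    by (rule nilsoliton_of_extension[OF \<nu> \<nu>skew finL, where D = D and H = "D H"])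
      (rule D Dder eq comm | assumption)+
  show False
    by (rule no_quadratic_nilsoliton[where D = "D H" and \<nu> = \<nu> and c = c and g = g, OF t g gbij ghom D Dder soliton])
qed

section \<open>The curve of Lie algebras\<close>

theorem mainTheorem2:
  shows "(\<forall>t>1. lie_algebra (mu_bar t) \<and> lie_nilpotent_on (mu_bar t) UNIV)
       \<and> (\<forall>t>1. \<forall>s>1. t \<noteq> s \<longrightarrow> \<not> lie_isomorphic (mu_bar t) (mu_bar s))
       \<and> (\<forall>t>1. \<not> einstein_nilradical TYPE('s::euclidean_space) (mu_bar t))
       \<and> (\<forall>t>1. \<not> admits_nilsoliton (mu_bar t))"
proof (intro conjI allI impI)
  fix t :: real
  assume t: "t > 1"
  show "lie_algebra (mu_bar t)" by (rule lie_algebra_mu_bar)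
  show "lie_nilpotent_on (mu_bar t) UNIV" by (rule nilpotent_mu_bar)
  show "\<not> lie_isomorphic (mu_bar t) (mu_bar s)" if "s > 1" "t \<noteq> s" for s
    by (rule not_isomorphic[OF t that])
  show "\<not> einstein_nilradical TYPE('s) (mu_bar t)"
    by (rule not_einstein_nilradical) (use t in simp)
  show "\<not> admits_nilsoliton (mu_bar t)"
    by (rule no_nilsoliton) (use t in simp)
qed

end
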